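(* Assume $\langle L_{N-1},L_{N-2}\rangle_1\neq0$ and $\langle L_{N-3},L_{N-4}\rangle_1\ne 0$. Let $\mathcal{M}$ be the moment matrix with entries $\langle r_j,r_k\rangle_1$, $j,k=0,\ldots,N-1$, where the sequence of monic polynomials $r_j(x)$ is chosen such that $r_j$ is an arbitrary monic polynomial of degree $j$ independent of $t$ for $j<N-2$, and $r_j=\pi_{j,1}$ for $j=N-2,N-1$. Then the logarithmic derivative of $\det\mathcal{M}$ with respect to $t$ is given by $$\frac{\partial}{\partial t}\log\det\mathcal{M}=\int_{\mathbb{R}_+}\frac{S_1(x,x)}{t-\tilde\tau x}\,dx ,$$ where $$S_1(x,y)=-\sum_{j,k=0}^{N-1}r_j(x)w(x)\mu_{jk}\,\epsilon(r_kw)(y),\qquad(\mu_{jk})=\mathcal{M}^{-1}.$$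
   Context: $M>N$ are integers with $N\geq 4$ even, $1+\tau>0$ is the non-trivial ($\tau\neq 0$) eigenvalue of the covariance matrix of a rank 1 real Wishart spiked model, $\tilde\tau=\frac{\tau}{2(1+\tau)}$, and $t$ is a complex parameter. $\mathbb{R}_+$ denotes the integration path from $0$ to $\infty$, namely $(0,\infty)$, deformed into the upper or lower half plane when the singularity $t/\tilde\tau$ of the weight is on or too close to $(0,\infty)$, so that the integrals are well defined; all integrals $\int_0^\infty$ are along this path. The weight is $$w(x)=e^{-\frac{Mx}{2}}x^{\frac{M-N-1}{2}}(t-\tilde\tau x)^{-\frac12}.$$ Put $\epsilon(x)=\frac12\mathrm{sgn}(x)$ (on a deformed path, the sign of $x-y$ is taken according to the order of $x$ and $y$ along the path), $\epsilon(f)(x)=\int_0^\infty\epsilon(x-y)f(y)\,dy$, and $$\langle f,g\rangle_1=\int_0^\infty\int_0^\infty\epsilon(x-y)f(x)g(y)w(x)w(y)\,dx\,dy .$$ $L_j$ is the monic Laguerre polynomial of degree $j$ orthogonal with respect to $w_0(x)=x^{M-N}e^{-Mx}$ on $(0,\infty)$. The monic skew orthogonal polynomials $\pi_{2k,1}$, $\pi_{2k+1,1}$ (of degrees $2k$, $2k+1$) satisfy $\langle\pi_{2k+1,1},y^j\rangle_1=\langle\pi_{2k,1},y^j\rangle_1=0$ for $j=0,\ldots,2k-1$; they exist if $\langle L_{2k-1},L_{2k-2}\rangle_1\ne0$, $\pi_{2k,1}$ is then unique, and $\pi_{2k+1,1}$ is unique up to adding a multiple of $\pi_{2k,1}$.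
   Formalization: The sign of the right-hand side is corrected: with the given definitions of S_1, ε and the skew product, the logarithmic derivative of det M equals minus the integral of S_1(x,x)/(t−τ̃x); the printed formula without the minus sign fails, e.g. for −1<τ<0 and generic t>0. *)

theory Defs
  imports
    "HOL-Analysis.Analysis"
    "Jordan_Normal_Form.Gauss_Jordan_Elimination"
    "Jordan_Normal_Form.Determinant"
begin

definition tau_tilde :: "real \<Rightarrow> real" where
  "tau_tilde \<tau> = \<tau> / (2 * (1 + \<tau>))"

(* The path from 0 to infinity: the half line, deformed into the closed upper or the closed
   lower half plane.  Library piecewise-C1 only asks for C1 off finitely many
   parameters; the Lipschitz bound excludes an unbounded derivative at those parameters.
   Avoiding the non-positive reals keeps the path inside the domain of the principal power. *)
definition half_line_path :: "(real \<Rightarrow> complex) \<Rightarrow> bool" where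
  "half_line_path \<gamma> \<longleftrightarrow>
     \<gamma> 0 = 0 \<and>
     \<gamma> piecewise_C1_differentiable_on {0..} \<and>
     (\<exists>C. C-lipschitz_on {0..} \<gamma>) \<and>
     inj_on \<gamma> {0..} \<and>
     (\<exists>R. \<forall>s\<ge>R. \<gamma> s = of_real s) \<and>
     (\<forall>s>0. \<gamma> s \<notin> \<real>\<^sub>\<le>\<^sub>0) \<and>
     ((\<forall>s\<ge>0. 0 \<le> Im (\<gamma> s)) \<or> (\<forall>s\<ge>0. Im (\<gamma> s) \<le> 0))"

(* Integral along the path; the integrand is given as a function of the path parameter. *)
definition path_int :: "(real \<Rightarrow> complex) \<Rightarrow> (real \<Rightarrow> complex) \<Rightarrow> complex" where
  "path_int \<gamma> F = (LINT s:{0..}|lborel. F s * vector_derivative \<gamma> (at s))"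

(* rt t x is a branch of (t - c x)^(1/2), jointly continuous in t and in x on the path.  The
   principal branch will not do, since t - c x may cross the negative real axis along the path.
   The condition that t - c x is nonzero says that the path avoids the singularity t / c. *)
definition sqrt_branch ::
    "real \<Rightarrow> (real \<Rightarrow> complex) \<Rightarrow> complex set \<Rightarrow> (complex \<Rightarrow> complex \<Rightarrow> complex) \<Rightarrow> bool" where
  "sqrt_branch c \<gamma> U rt \<longleftrightarrow>
     continuous_on (U \<times> \<gamma> ` {0..}) (\<lambda>(t, x). rt t x) \<and>
     (\<forall>t\<in>U. \<forall>x\<in>\<gamma> ` {0..}. t - of_real c * x \<noteq> 0 \<and> (rt t x)\<^sup>2 = t - of_real c * x)"

definition weight ::
    "nat \<Rightarrow> nat \<Rightarrow> (complex \<Rightarrow> complex \<Rightarrow> complex) \<Rightarrow> complex \<Rightarrow> complex \<Rightarrow> complex" where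
  "weight M N rt t x =
     exp (- (of_nat M * x / 2)) * x powr of_real ((real M - real N - 1) / 2) / rt t x"

(* epsilon(x - y) for x, y the points of the path with parameters s, u. *)
definition eps :: "real \<Rightarrow> real \<Rightarrow> complex" where
  "eps s u = of_real (sgn (s - u) / 2)"

(* epsilon(f) at the point of the path with parameter s. *)
definition eps_op :: "(real \<Rightarrow> complex) \<Rightarrow> (complex \<Rightarrow> complex) \<Rightarrow> real \<Rightarrow> complex" where
  "eps_op \<gamma> f s = path_int \<gamma> (\<lambda>u. eps s u * f (\<gamma> u))"

definition skew_prod ::
    "(real \<Rightarrow> complex) \<Rightarrow> (complex \<Rightarrow> complex) \<Rightarrow> (complex \<Rightarrow> complex) \<Rightarrow> (complex \<Rightarrow> complex) \<Rightarrow> complex"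
  where
  "skew_prod \<gamma> w f g =
     path_int \<gamma> (\<lambda>s. path_int \<gamma> (\<lambda>u.
       eps s u * f (\<gamma> s) * g (\<gamma> u) * w (\<gamma> s) * w (\<gamma> u)))"

definition monic_of_degree :: "nat \<Rightarrow> 'a::comm_ring_1 poly \<Rightarrow> bool" where
  "monic_of_degree n p \<longleftrightarrow> degree p = n \<and> lead_coeff p = 1"

(* This determines L uniquely. *)
definition monic_laguerre :: "nat \<Rightarrow> nat \<Rightarrow> (nat \<Rightarrow> real poly) \<Rightarrow> bool" where
  "monic_laguerre M N L \<longleftrightarrow>
     (\<forall>j. monic_of_degree j (L j)) \<and>
     (\<forall>j. \<forall>i<j. (LINT x:{0<..}|lborel.
        poly (L j) x * poly (L i) x * (x ^ (M - N) * exp (- (real M * x)))) = 0)"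

definition laguerre_skew ::
    "(real \<Rightarrow> complex) \<Rightarrow> (complex \<Rightarrow> complex) \<Rightarrow> (nat \<Rightarrow> real poly) \<Rightarrow> nat \<Rightarrow> nat \<Rightarrow> complex" where
  "laguerre_skew \<gamma> w L i j =
     skew_prod \<gamma> w (poly (map_poly of_real (L i))) (poly (map_poly of_real (L j)))"

(* For n = 2k and for n = 2k+1 alike, the orthogonality runs over the powers 0, ..., 2k-1. *)
definition skew_orthogonal_poly ::
    "(real \<Rightarrow> complex) \<Rightarrow> (complex \<Rightarrow> complex) \<Rightarrow> nat \<Rightarrow> complex poly \<Rightarrow> bool" where
  "skew_orthogonal_poly \<gamma> w n p \<longleftrightarrow>
     monic_of_degree n p \<and>
     (\<forall>j < 2 * (n div 2). skew_prod \<gamma> w (poly p) (\<lambda>y. y ^ j) = 0)"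

definition moment_mat ::
    "(real \<Rightarrow> complex) \<Rightarrow> (complex \<Rightarrow> complex) \<Rightarrow> nat \<Rightarrow> (nat \<Rightarrow> complex poly) \<Rightarrow> complex Matrix.mat" where
  "moment_mat \<gamma> w N r = Matrix.mat N N (\<lambda>(j, k). skew_prod \<gamma> w (poly (r j)) (poly (r k)))"

definition moment_det ::
    "(real \<Rightarrow> complex) \<Rightarrow> (complex \<Rightarrow> complex) \<Rightarrow> nat \<Rightarrow> (nat \<Rightarrow> complex poly) \<Rightarrow> complex" where
  "moment_det \<gamma> w N r = Determinant.det (moment_mat \<gamma> w N r)"

(* S_1(x,y) at the points x, y of the path with parameters s, u.  With this sign the integral of
   S_1(x,x) along the path is +N: the moment matrix and its inverse are antisymmetric, so that
   - sum_jk mu_jk M_jk = sum_jk mu_jk M_kj = N. *)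
definition S1 ::
    "(real \<Rightarrow> complex) \<Rightarrow> (complex \<Rightarrow> complex) \<Rightarrow> nat \<Rightarrow> (nat \<Rightarrow> complex poly) \<Rightarrow> real \<Rightarrow> real \<Rightarrow> complex"
  where
  "S1 \<gamma> w N r s u =
     (let \<mu> = the (mat_inverse (moment_mat \<gamma> w N r)) in
      - (\<Sum>j<N. \<Sum>k<N. poly (r j) (\<gamma> s) * w (\<gamma> s) * (\<mu> $$ (j, k))
            * eps_op \<gamma> (\<lambda>y. poly (r k) y * w y) u))"

end

theory Submission
  imports
    Defs
    "HOL-Complex_Analysis.Cauchy_Integral_Theorem"
    "HOL-Probability.Sinc_Integral"
    "HOL-Real_Asymp.Real_Asymp"
begin

text \<open>
  Write \<open>c\<close> for the parameter called \<open>tau_tilde\<close>, and \<open>\<langle>f, g\<rangle>\<close> for the skew product at a given \<open>t\<close>.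

  Passing from one monic family to another changes the moment matrix by a unitriangular congruence,
  so \<open>det M(t)\<close> is the same for every monic family (\<open>moment_det_monic\<close>), in particular for the
  family \<open>r(t0)\<close> at the base point.  For a fixed family only the weight moves, and
  \<open>\<partial>w/\<partial>t = - w / (2 (t - c x))\<close>.  Hence each moment can be differentiated under the double integral
  (\<open>leibniz_rule_lebesgue_field_derivative\<close>, \<open>eps_form_has_field_derivative\<close>), and Jacobi's formula
  (\<open>has_field_derivative_det\<close>) gives \<open>(log det M)' = \<Sum> \<mu>\<^sub>j\<^sub>k M'\<^sub>k\<^sub>j\<close>.  The two halves of \<open>M'\<^sub>k\<^sub>j\<close>, one
  from each variable of the double integral, contribute equally because both the form and \<open>\<mu>\<close> are
  antisymmetric; the sum of the two is \<open>\<Sum> \<mu>\<^sub>j\<^sub>k \<integral> r\<^sub>j w \<epsilon>(r\<^sub>k w) / (t - c x) dx\<close>, which is minus the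
  integral of \<open>S1(x, x) / (t - c x)\<close>.

  The other point is that \<open>det M(t0)\<close> does not vanish.  For a polynomial \<open>q\<close> of degree at most
  \<open>N - 3\<close> the function \<open>q x (t - c x) w\<close> has a derivative of the form \<open>(D q) w\<close> with \<open>D q\<close> a
  polynomial of degree at most \<open>N - 1\<close>, and it vanishes at both ends of the path.  Since \<open>\<epsilon>\<close> inverts
  differentiation, \<open>\<langle>f, D q\<rangle> = \<integral> f q x (t - c x) w\<^sup>2 dx = \<integral> f q x\<^sup>M\<^sup>-\<^sup>N exp (- M x) dx\<close>
  (\<open>eps_form_density_deriv_operator\<close>).  The last integrand is entire, so the path can be moved back
  to the real half line, where this is the Laguerre moment of \<open>f q\<close>.  Therefore an element \<open>f\<close> of
  the kernel of the form on polynomials of degree below \<open>N\<close> is a combination of \<open>L\<^sub>N\<^sub>-\<^sub>1\<close> and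
  \<open>L\<^sub>N\<^sub>-\<^sub>2\<close>; pairing it with these two and using \<open>\<langle>L\<^sub>N\<^sub>-\<^sub>1, L\<^sub>N\<^sub>-\<^sub>2\<rangle> \<noteq> 0\<close> shows \<open>f = 0\<close>
  (\<open>skew_form_kernel_trivial\<close>).
\<close>

section \<open>Determinants, Gram matrices and monic families\<close>

text \<open>In the Leibniz expansion a permutation other than the identity moves at least two
  indices, so even after one factor of its product is differentiated an off-diagonal entry of
  the identity matrix remains, and the whole term vanishes at \<open>t0\<close>. What survives is the
  trace.\<close>

lemma has_field_derivative_det_at_one:
  fixes P :: "'a::real_normed_field \<Rightarrow> 'a Matrix.mat"
  assumes dim: "\<And>t. P t \<in> carrier_mat n n" and one: "P t0 = 1\<^sub>m n"
    and der: "\<And>i j. i < n \<Longrightarrow> j < n \<Longrightarrow>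
      ((\<lambda>t. P t $$ (i, j)) has_field_derivative P' i j) (at t0)"
  shows "((\<lambda>t. Determinant.det (P t)) has_field_derivative (\<Sum>i<n. P' i i)) (at t0)"
proof -
  let ?S = "{p. p permutes {0..<n}}"
  let ?d = "\<lambda>p. signof p * (\<Sum>i\<in>{0..<n}. P' i (p i) * (\<Prod>j\<in>{0..<n} - {i}. P t0 $$ (j, p j)))"
  have det: "Determinant.det (P t) = (\<Sum>p\<in>?S. signof p * (\<Prod>i\<in>{0..<n}. P t $$ (i, p i)))" for t
    using dim[of t] by (simp add: Determinant.det_def)
  have fin: "finite ?S" by (simp add: finite_permutations)
  have "((\<lambda>t. Determinant.det (P t)) has_field_derivative (\<Sum>p\<in>?S. ?d p)) (at t0)"
    unfolding det
  proof (intro DERIV_sum DERIV_cmult has_field_derivative_prod)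
    fix p i assume "p \<in> ?S" "i \<in> {0..<n}"
    then have "i < n" "p permutes {0..<n}" by auto
    then have "i < n" "p i < n"
      using permutes_in_image[of p "{0..<n}" i] by auto
    then show "((\<lambda>t. P t $$ (i, p i)) has_field_derivative P' i (p i)) (at t0)"
      by (rule der)
  qed
  moreover have "?d p = 0" if p: "p \<in> ?S - {id}" for p
  proof -
    from p obtain l where l: "p l \<noteq> l" by (metis DiffE eq_id_iff insert_iff)
    have pp: "p permutes {0..<n}" using p by simp
    have inj: "inj p" using pp by (rule permutes_inj)
    have l2: "p (p l) \<noteq> p l" using l inj by (auto dest: injD)
    have ln: "l < n" using l pp by (auto simp: permutes_def)
    have pln: "p l < n" using l2 pp by (auto simp: permutes_def)
    have "(\<Prod>j\<in>{0..<n} - {i}. P t0 $$ (j, p j)) = 0" for i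
    proof -
      obtain l' where l': "l' < n" "l' \<noteq> i" "p l' \<noteq> l'"
        using l l2 ln pln by (cases "l = i") auto
      moreover have "p l' < n"
        using l'(1) pp permutes_in_image[of p "{0..<n}" l'] by auto
      ultimately have "P t0 $$ (l', p l') = 0" using one by simp
      with l' show ?thesis by (intro prod_zero) (auto intro!: bexI[of _ l'])
    qed
    then show ?thesis by (simp del: prod_zero_iff)
  qed
  then have "(\<Sum>p\<in>?S. ?d p) = ?d id"
    using fin by (subst sum.remove[of _ id]) (simp_all add: permutes_id sum.neutral)
  moreover have "?d id = (\<Sum>i<n. P' i i)"
    by (auto simp: one sign_id atLeast0LessThan intro!: sum.cong)
  ultimately show ?thesis by simp
qed

text \<open>Jacobi's formula. The matrix \<open>B * A t\<close> is the identity at \<open>t0\<close>, so the derivative of its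
  determinant is a trace, and \<open>det (A t) = det (A t0) * det (B * A t)\<close>.\<close>

lemma has_field_derivative_det:
  fixes A :: "'a::real_normed_field \<Rightarrow> 'a Matrix.mat"
  assumes dim: "\<And>t. A t \<in> carrier_mat n n" and B: "B \<in> carrier_mat n n"
    and inv: "B * A t0 = 1\<^sub>m n"
    and der: "\<And>i j. i < n \<Longrightarrow> j < n \<Longrightarrow>
      ((\<lambda>t. A t $$ (i, j)) has_field_derivative A' i j) (at t0)"
  shows "((\<lambda>t. Determinant.det (A t)) has_field_derivative
    Determinant.det (A t0) * (\<Sum>i<n. \<Sum>j<n. B $$ (i, j) * A' j i)) (at t0)"
proof -
  have BA: "B * A t \<in> carrier_mat n n" for t using B dim by simp
  have mult: "Determinant.det (B * A t) = Determinant.det B * Determinant.det (A t)" for t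
    using B dim by (rule det_mult)
  have "Determinant.det B * Determinant.det (A t0) = 1"
    using mult[of t0] inv by simp
  then have det: "Determinant.det (A t) = Determinant.det (A t0) * Determinant.det (B * A t)" for t
  proof -
    have "Determinant.det (A t0) * Determinant.det (B * A t) =
        (Determinant.det B * Determinant.det (A t0)) * Determinant.det (A t)"
      unfolding mult by (simp only: mult_ac)
    with \<open>Determinant.det B * Determinant.det (A t0) = 1\<close> show ?thesis by simp
  qed
  have "((\<lambda>t. Determinant.det (B * A t)) has_field_derivative
      (\<Sum>i<n. \<Sum>j<n. B $$ (i, j) * A' j i)) (at t0)"
  proof (rule has_field_derivative_det_at_one[where P = "\<lambda>t. B * A t"
      and P' = "\<lambda>i j. \<Sum>l<n. B $$ (i, l) * A' l j", OF BA inv])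
    fix i j assume ij: "i < n" "j < n"
    have "(B * A t) $$ (i, j) = (\<Sum>l<n. B $$ (i, l) * A t $$ (l, j))" for t
      using ij B dim[of t] by (simp add: scalar_prod_def atLeast0LessThan)
    moreover have "((\<lambda>t. \<Sum>l<n. B $$ (i, l) * A t $$ (l, j)) has_field_derivative
        (\<Sum>l<n. B $$ (i, l) * A' l j)) (at t0)"
      using ij by (intro DERIV_sum DERIV_cmult der) auto
    ultimately show "((\<lambda>t. (B * A t) $$ (i, j)) has_field_derivative
        (\<Sum>l<n. B $$ (i, l) * A' l j)) (at t0)" by simp
  qed
  then show ?thesis by (subst det) (rule DERIV_cmult)
qed

text \<open>The matrix \<open>C\<close> of coefficients of a monic family is lower unitriangular, and the Gram
  matrix of the family is \<open>C G C\<^sup>T\<close> with \<open>G\<close> the Gram matrix \<open>m\<close> of the monomials.\<close>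

lemma det_gram_monic:
  fixes \<beta> :: "'a::comm_ring_1 poly \<Rightarrow> 'a poly \<Rightarrow> 'a"
  assumes \<beta>: "\<And>p q. degree p < n \<Longrightarrow> degree q < n \<Longrightarrow>
      \<beta> p q = (\<Sum>i<n. \<Sum>k<n. coeff p i * m i k * coeff q k)"
    and r: "\<And>j. j < n \<Longrightarrow> monic_of_degree j (r j)"
  shows "Determinant.det (Matrix.mat n n (\<lambda>(j, k). \<beta> (r j) (r k))) =
    Determinant.det (Matrix.mat n n (\<lambda>(i, k). m i k))"
proof -
  define C where "C = Matrix.mat n n (\<lambda>(j, i). coeff (r j) i)"
  define G where "G = Matrix.mat n n (\<lambda>(i, k). m i k)"
  have C: "C \<in> carrier_mat n n" and G: "G \<in> carrier_mat n n" by (auto simp: C_def G_def)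
  have "Matrix.mat n n (\<lambda>(j, k). \<beta> (r j) (r k)) = C * G * transpose_mat C"
  proof (rule eq_matI)
    fix j k assume "j < dim_row (C * G * transpose_mat C)" "k < dim_col (C * G * transpose_mat C)"
    then have jk: "j < n" "k < n" by (auto simp: C_def)
    then have "degree (r j) < n" "degree (r k) < n" using r by (auto simp: monic_of_degree_def)
    then have "\<beta> (r j) (r k) = (\<Sum>i<n. \<Sum>l<n. coeff (r j) i * m i l * coeff (r k) l)" by (rule \<beta>)
    also have "\<dots> = (\<Sum>l<n. (\<Sum>i<n. coeff (r j) i * m i l) * coeff (r k) l)"
      by (subst sum.swap) (simp add: sum_distrib_right)
    also have "\<dots> = (C * G * transpose_mat C) $$ (j, k)"
      using jk by (simp add: C_def G_def scalar_prod_def atLeast0LessThan)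
    finally show "Matrix.mat n n (\<lambda>(j, k). \<beta> (r j) (r k)) $$ (j, k) = (C * G * transpose_mat C) $$
        (j, k)"
      using jk by simp
  qed (auto simp: C_def)
  moreover have "Determinant.det C = 1"
  proof -
    have "Determinant.det C = prod_list (diag_mat C)"
    proof (rule det_lower_triangular[OF _ C])
      fix i j assume "i < j" "j < n"
      with r[of i] show "C $$ (i, j) = 0" by (auto simp: C_def monic_of_degree_def coeff_eq_0)
    qed
    also have "diag_mat C = map (\<lambda>i. 1) [0..<n]"
      unfolding diag_mat_def using r by (fastforce simp: C_def monic_of_degree_def)
    finally show ?thesis by (simp add: prod_list_replicate map_replicate_const)
  qed
  ultimately show ?thesis
    using C G by (simp add: det_mult[of _ n] det_transpose[of _ n] G_def)
qed

text \<open>A null vector of the matrix, read as the list of coefficients of a polynomial.\<close>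

lemma singular_matrix_poly_kernel:
  fixes m :: "nat \<Rightarrow> nat \<Rightarrow> 'a::idom"
  assumes n: "0 < n" and det: "Determinant.det (Matrix.mat n n (\<lambda>(i, k). m i k)) = 0"
  obtains f where "f \<noteq> 0" "degree f < n" "\<And>i. i < n \<Longrightarrow> (\<Sum>k<n. m i k * coeff f k) = 0"
proof -
  define G where "G = Matrix.mat n n (\<lambda>(i, k). m i k)"
  have G: "G \<in> carrier_mat n n" by (simp add: G_def)
  from det obtain v where v: "v \<in> carrier_vec n" "v \<noteq> 0\<^sub>v n" "G *\<^sub>v v = 0\<^sub>v n"
    using det_0_iff_vec_prod_zero[OF G] by (auto simp: G_def)
  define f where "f = (\<Sum>k<n. monom (vec_index v k) k)"
  have cf: "coeff f k = (if k < n then vec_index v k else 0)" for k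
    by (simp add: f_def coeff_sum sum.delta)
  have "f \<noteq> 0"
  proof
    assume "f = 0"
    then have "vec_index v k = 0" if "k < n" for k using cf[of k] that by simp
    then have "v = 0\<^sub>v n" using v(1) by (intro eq_vecI) auto
    with v(2) show False ..
  qed
  moreover have "degree f < n"
    using n by (intro degree_lessI) (auto simp: cf)
  moreover have "(\<Sum>k<n. m i k * coeff f k) = 0" if "i < n" for i
  proof -
    have "vec_index (G *\<^sub>v v) i = (\<Sum>k<n. m i k * vec_index v k)"
      using that v(1) by (simp add: G_def scalar_prod_def atLeast0LessThan)
    also have "\<dots> = (\<Sum>k<n. m i k * coeff f k)" by (rule sum.cong) (auto simp: cf)
    finally show ?thesis unfolding v(3) using that by simp
  qed
  ultimately show ?thesis by (rule that)
qed

text \<open>Subtracting a multiple of the member of top degree lowers the degree, so a linear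
  condition that holds on a monic family holds on its span, the polynomials of degree below
  \<open>n\<close>. The bound is put as vanishing of coefficients to include the zero polynomial when \<open>n =
  0\<close>.\<close>

lemma monic_family_span:
  fixes L :: "nat \<Rightarrow> 'a::comm_ring_1 poly"
  assumes L: "\<And>j. j < n \<Longrightarrow> monic_of_degree j (L j)"
    and P: "\<And>j. j < n \<Longrightarrow> P (L j)" "P 0" "\<And>p q. P p \<Longrightarrow> P q \<Longrightarrow> P (p + q)"
      "\<And>a p. P p \<Longrightarrow> P (Polynomial.smult a p)"
  shows "\<forall>k\<ge>n. coeff q k = 0 \<Longrightarrow> P q"
  using L P(1)
proof (induction n arbitrary: q)
  case 0
  then have "q = 0" by (simp add: poly_eq_iff)
  then show ?case using P(2) by simp
next
  case (Suc n)
  define q' where "q' = q - Polynomial.smult (coeff q n) (L n)"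
  have Ln: "degree (L n) = n" "coeff (L n) n = 1"
    using Suc.prems(2)[of n] by (auto simp: monic_of_degree_def)
  have "coeff q' k = 0" if "k \<ge> n" for k
  proof (cases "k = n")
    case True then show ?thesis by (simp add: q'_def Ln)
  next
    case False
    with that have "k \<ge> Suc n" "degree (L n) < k" using Ln by auto
    then show ?thesis using Suc.prems(1) by (simp add: q'_def coeff_eq_0)
  qed
  then have "\<forall>k\<ge>n. coeff q' k = 0" by blast
  then have "P q'"
    by (rule Suc.IH) (use Suc.prems(2,3) less_SucI in blast)+
  then have "P (q' + Polynomial.smult (coeff q n) (L n))"
    by (intro P(3) P(4) Suc.prems(3)) simp_all
  then show ?case by (simp add: q'_def)
qed

text \<open>Transposing \<open>A B = 1\<close> shows that minus the transpose of \<open>B\<close> is also an inverse of \<open>A\<close>.\<close>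

lemma antisymmetric_inverse:
  fixes A B :: "'a::field Matrix.mat"
  assumes A: "A \<in> carrier_mat n n" and B: "B \<in> carrier_mat n n"
    and AB: "A * B = 1\<^sub>m n" and BA: "B * A = 1\<^sub>m n"
    and anti: "\<And>i j. i < n \<Longrightarrow> j < n \<Longrightarrow> A $$ (i, j) = - A $$ (j, i)"
    and ij: "i < n" "j < n"
  shows "B $$ (i, j) = - B $$ (j, i)"
proof -
  let ?T = "transpose_mat B"
  have T: "?T \<in> carrier_mat n n" using B by simp
  have "transpose_mat A = - A"
  proof (rule eq_matI)
    fix k l assume "k < dim_row (- A)" "l < dim_col (- A)"
    with A have kl: "k < n" "l < n" by auto
    with A show "transpose_mat A $$ (k, l) = (- A) $$ (k, l)" using anti[of l k] by simp
  qed (use A in auto)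
  then have "?T * (- A) = 1\<^sub>m n"
    using transpose_mult[OF A B] AB by simp
  moreover have "?T * (- A) = - (?T * A)"
    using T A by (intro uminus_mult_right_mat) auto
  ultimately have "?T * A = - 1\<^sub>m n"
    by (metis uminus_uminus_mat)
  then have "?T * A * B = - B" using B by simp
  moreover have "?T * A * B = ?T" using assoc_mult_mat[OF T A B] AB T by simp
  ultimately have "?T = - B" by simp
  then have "?T $$ (j, i) = (- B) $$ (j, i)" by simp
  then show ?thesis using B ij by simp
qed

section \<open>Differentiation under the integral and the sign form\<close>

text \<open>On the ball the mean value inequality bounds every difference quotient by the dominating
  function \<open>g\<close>, so dominated convergence applies along each sequence tending to \<open>t0\<close>.\<close>

lemma leibniz_rule_lebesgue_field_derivative:
  fixes F :: "complex \<Rightarrow> 'a \<Rightarrow> complex"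
  assumes d: "0 < d"
    and int: "\<And>t. t \<in> ball t0 d \<Longrightarrow> integrable M (F t)"
    and der: "\<And>t x. t \<in> ball t0 d \<Longrightarrow> x \<in> space M \<Longrightarrow>
      ((\<lambda>t. F t x) has_field_derivative F' t x) (at t)"
    and bound: "\<And>t x. t \<in> ball t0 d \<Longrightarrow> x \<in> space M \<Longrightarrow> norm (F' t x) \<le> g x"
    and g: "integrable M g"
    and meas: "F' t0 \<in> borel_measurable M"
  shows "((\<lambda>t. \<integral>x. F t x \<partial>M) has_field_derivative (\<integral>x. F' t0 x \<partial>M)) (at t0)"
  unfolding has_field_derivative_iff
proof (subst tendsto_at_iff_sequentially, intro allI impI)
  fix X :: "nat \<Rightarrow> complex"
  assume X: "\<forall>i. X i \<in> UNIV - {t0}" and lim: "X \<longlonglongrightarrow> t0"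
  from lim d have "eventually (\<lambda>n. X n \<in> ball t0 d) sequentially"
    by (auto simp: tendsto_iff dist_commute)
  then obtain n0 where n0: "\<And>n. n \<ge> n0 \<Longrightarrow> X n \<in> ball t0 d"
    by (auto simp: eventually_sequentially)
  define Y where "Y n = X (n + n0)" for n
  have Y: "Y n \<in> ball t0 d" "Y n \<noteq> t0" for n
    using n0[of "n + n0"] X by (auto simp: Y_def)
  have Ylim: "Y \<longlonglongrightarrow> t0" unfolding Y_def using lim by (rule LIMSEQ_ignore_initial_segment)
  have t0: "t0 \<in> ball t0 d" using d by simp
  define s where "s n x = (F (Y n) x - F t0 x) / (Y n - t0)" for n x
  have s_lim: "(\<lambda>n. s n x) \<longlonglongrightarrow> F' t0 x" if x: "x \<in> space M" for x
  proof -
    have "((\<lambda>t. (F t x - F t0 x) / (t - t0)) \<longlongrightarrow> F' t0 x) (at t0)"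
      using der[OF t0 x] by (simp add: has_field_derivative_iff)
    then show ?thesis
      unfolding tendsto_at_iff_sequentially s_def using Y(2) Ylim by (auto simp: o_def)
  qed
  have s_bound: "norm (s n x) \<le> g x" if x: "x \<in> space M" for n x
  proof -
    have "norm (F (Y n) x - F t0 x) \<le> g x * norm (Y n - t0)"
    proof (rule field_differentiable_bound[of "ball t0 d" "\<lambda>t. F t x" "\<lambda>t. F' t x"])
      fix z assume "z \<in> ball t0 d"
      then show "((\<lambda>t. F t x) has_field_derivative F' z x) (at z within ball t0 d)"
        using der[OF _ x] by (blast intro: has_field_derivative_at_within)
    qed (use bound[OF _ x] Y(1) t0 in auto)
    then show ?thesis using Y(2)[of n] by (simp add: s_def norm_divide divide_le_eq)
  qed
  have "(\<lambda>n. \<integral>x. s n x \<partial>M) \<longlonglongrightarrow> (\<integral>x. F' t0 x \<partial>M)"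
  proof (rule integral_dominated_convergence[OF meas _ g])
    show "s n \<in> borel_measurable M" for n
      unfolding s_def using int[OF Y(1)[of n]] int[OF t0] by measurable
  qed (use s_lim s_bound in auto)
  moreover have "(\<integral>x. s n x \<partial>M) = ((\<integral>x. F (Y n) x \<partial>M) - (\<integral>x. F t0 x \<partial>M)) / (Y n - t0)" for n
    unfolding s_def using int[OF Y(1)[of n]] int[OF t0] by simp
  ultimately have "(\<lambda>n. ((\<integral>x. F (X (n + n0)) x \<partial>M) - (\<integral>x. F t0 x \<partial>M)) / (X (n + n0) - t0))
      \<longlonglongrightarrow> (\<integral>x. F' t0 x \<partial>M)"
    by (simp add: Y_def)
  then show "((\<lambda>t. ((\<integral>x. F t x \<partial>M) - (\<integral>x. F t0 x \<partial>M)) / (t - t0)) \<circ> X)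
      \<longlonglongrightarrow> (\<integral>x. F' t0 x \<partial>M)"
    unfolding o_def by (rule LIMSEQ_offset[where k = n0])
qed

text \<open>The parametrised versions of \<open>\<epsilon>(f)\<close> and of the skew product: \<open>a\<close> and \<open>b\<close> stand for
  functions on the path already multiplied by the weight and by the derivative of the path, so
  that plain Lebesgue integrals over the real line remain.\<close>

definition eps_transform :: "(real \<Rightarrow> complex) \<Rightarrow> real \<Rightarrow> complex" where
  "eps_transform b s = (LINT u|lborel. eps s u * b u)"

definition eps_form :: "(real \<Rightarrow> complex) \<Rightarrow> (real \<Rightarrow> complex) \<Rightarrow> complex" where
  "eps_form a b = (LINT s|lborel. a s * eps_transform b s)"

lemma eps_commute: "eps u s = - eps s u"
  by (simp add: eps_def sgn_minus[of "s - u", symmetric] flip: of_real_minus)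

lemma norm_eps_le: "norm (eps s u) \<le> 1"
  by (auto simp: eps_def sgn_if)

lemma measurable_eps[measurable]: "(\<lambda>(s, u). eps s u) \<in> borel_measurable (borel \<Otimes>\<^sub>M borel)"
  unfolding eps_def by measurable

context
  fixes a b :: "real \<Rightarrow> complex"
  assumes a: "integrable lborel a" and b: "integrable lborel b"
begin

lemma integrable_norm_product:
  "integrable (lborel \<Otimes>\<^sub>M lborel) (\<lambda>(s, u). norm (a s) * norm (b u))"
proof -
  have [measurable]: "a \<in> borel_measurable borel" "b \<in> borel_measurable borel"
    using a b by (auto dest: borel_measurable_integrable)
  show ?thesis
    by (rule lborel_pair.Fubini_integrable)
       (use a b in \<open>auto intro!: integrable_mult_right integrable_mult_left integrable_norm\<close>)
qed

lemma integrable_eps_product: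
  "integrable (lborel \<Otimes>\<^sub>M lborel) (\<lambda>(s, u). eps s u * (a s * b u))"
proof (rule Bochner_Integration.integrable_bound[OF integrable_norm_product])
  have [measurable]: "a \<in> borel_measurable borel" "b \<in> borel_measurable borel"
    using a b by (auto dest: borel_measurable_integrable)
  show "(\<lambda>(s, u). eps s u * (a s * b u)) \<in> borel_measurable (lborel \<Otimes>\<^sub>M lborel)"
    by measurable
  show "AE x in lborel \<Otimes>\<^sub>M lborel. norm (case x of (s, u) \<Rightarrow> eps s u * (a s * b u))
      \<le> norm (case x of (s, u) \<Rightarrow> norm (a s) * norm (b u))"
    using norm_eps_le by (intro AE_I2) (auto simp: norm_mult intro!: mult_left_le_one_le)
qed

lemma integrable_mult_eps_transform: "integrable lborel (\<lambda>s. a s * eps_transform b s)"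
  using lborel_pair.integrable_fst[OF integrable_eps_product]
  by (simp add: eps_transform_def mult.left_commute)

lemma eps_form_eq_product_integral:
  "eps_form a b = (\<integral>(s, u). eps s u * (a s * b u) \<partial>(lborel \<Otimes>\<^sub>M lborel))"
  using lborel_pair.integral_fst[OF integrable_eps_product]
  by (simp add: eps_form_def eps_transform_def mult.left_commute)

text \<open>Fubini, since the kernel is odd under exchange of its arguments.\<close>

lemma eps_form_swap: "eps_form b a = - eps_form a b"
proof -
  have "eps_form a b = (LINT u|lborel. LINT s|lborel. eps s u * (a s * b u))"
    using lborel_pair.integral_snd[OF integrable_eps_product]
    by (simp add: eps_form_eq_product_integral)
  also have "\<dots> = (LINT u|lborel. - (b u * eps_transform a u))"
  proof (rule Bochner_Integration.integral_cong[OF refl])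
    fix u
    have "eps s u * (a s * b u) = (- b u) * (eps u s * a s)" for s
      by (simp add: eps_commute[of s u])
    then show "(LINT s|lborel. eps s u * (a s * b u)) = - (b u * eps_transform a u)"
      by (simp add: eps_transform_def)
  qed
  finally show ?thesis by (simp add: eps_form_def)
qed

end

lemma eps_form_sum_left:
  assumes "\<And>i. i \<in> I \<Longrightarrow> integrable lborel (a i)" "integrable lborel b"
  shows "eps_form (\<lambda>s. \<Sum>i\<in>I. c i * a i s) b = (\<Sum>i\<in>I. c i * eps_form (a i) b)"
  unfolding eps_form_def sum_distrib_right mult.assoc
  using integrable_mult_eps_transform[OF assms(1) assms(2)]
  by (subst Bochner_Integration.integral_sum) auto

lemma eps_form_sum_right:
  assumes "integrable lborel a" "\<And>i. i \<in> I \<Longrightarrow> integrable lborel (b i)"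
  shows "eps_form a (\<lambda>s. \<Sum>i\<in>I. c i * b i s) = (\<Sum>i\<in>I. c i * eps_form a (b i))"
proof -
  have int: "integrable lborel (\<lambda>s. \<Sum>i\<in>I. c i * b i s)" using assms(2) by auto
  have "eps_form a (\<lambda>s. \<Sum>i\<in>I. c i * b i s) = - (\<Sum>i\<in>I. c i * eps_form (b i) a)"
    using eps_form_swap[OF int assms(1)] eps_form_sum_left[OF assms(2,1), where I = I and c = c] by simp
  also have "\<dots> = (\<Sum>i\<in>I. c i * eps_form a (b i))"
    using eps_form_swap[OF assms(2) assms(1)] by (simp add: sum_negf)
  finally show ?thesis .
qed

text \<open>Product rule for the form when the parameter enters through a common factor \<open>\<rho>\<close> that is
  bounded together with its derivative: the integrand on the product space is then dominated
  by a multiple of \<open>\<bar>A(s)\<bar> \<bar>B(u)\<bar>\<close>.\<close>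

lemma eps_form_has_field_derivative:
  fixes A B :: "real \<Rightarrow> complex" and \<rho> \<rho>' :: "complex \<Rightarrow> real \<Rightarrow> complex"
  assumes A: "integrable lborel A" and B: "integrable lborel B" and d: "0 < d"
    and meas: "\<And>t. t \<in> ball t0 d \<Longrightarrow> \<rho> t \<in> borel_measurable borel" "\<rho>' t0 \<in> borel_measurable borel"
    and der: "\<And>t s. t \<in> ball t0 d \<Longrightarrow> ((\<lambda>t. \<rho> t s) has_field_derivative \<rho>' t s) (at t)"
    and bound: "\<And>t s. t \<in> ball t0 d \<Longrightarrow> norm (\<rho> t s) \<le> K" "\<And>t s. t \<in> ball t0 d \<Longrightarrow> norm (\<rho>' t s) \<le> K"
  shows "((\<lambda>t. eps_form (\<lambda>s. A s * \<rho> t s) (\<lambda>s. B s * \<rho> t s)) has_field_derivative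
     eps_form (\<lambda>s. A s * \<rho>' t0 s) (\<lambda>s. B s * \<rho> t0 s)
     + eps_form (\<lambda>s. A s * \<rho> t0 s) (\<lambda>s. B s * \<rho>' t0 s)) (at t0)"
proof -
  have t0: "t0 \<in> ball t0 d" using d by simp
  have K: "0 \<le> K" using bound(1)[OF t0] norm_ge_zero order_trans by blast
  have [measurable]: "A \<in> borel_measurable borel" "B \<in> borel_measurable borel"
    using A B by (auto dest: borel_measurable_integrable)
  have mult_int: "integrable lborel (\<lambda>s. C s * r s)"
    if C: "integrable lborel C" and r: "r \<in> borel_measurable borel" "\<And>s. norm (r s) \<le> K"
    for C r :: "real \<Rightarrow> complex"
  proof (rule Bochner_Integration.integrable_bound)
    show "integrable lborel (\<lambda>s. K * norm (C s))" using C by auto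
    show "(\<lambda>s. C s * r s) \<in> borel_measurable lborel"
      using C r by (auto dest: borel_measurable_integrable)
    show "AE s in lborel. norm (C s * r s) \<le> norm (K * norm (C s))"
      using r(2) K by (auto simp: norm_mult mult.commute[of K] abs_mult intro!: mult_left_mono)
  qed
  have A\<rho>: "integrable lborel (\<lambda>s. A s * \<rho> t s)" and B\<rho>: "integrable lborel (\<lambda>s. B s * \<rho> t s)"
    if "t \<in> ball t0 d" for t
    using mult_int A B meas(1) bound(1) that by blast+
  have A\<rho>': "integrable lborel (\<lambda>s. A s * \<rho>' t0 s)" and B\<rho>': "integrable lborel (\<lambda>s. B s * \<rho>' t0 s)"
    using mult_int A B meas(2) bound(2)[OF t0] by blast+
  note \<rho>0[measurable] = meas(1)[OF t0]
  note [measurable] = meas(2)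
  define F where "F t z = (case z of (s, u) \<Rightarrow> eps s u * ((A s * \<rho> t s) * (B u * \<rho> t u)))" for t z
  define F' where "F' t z = (case z of (s, u) \<Rightarrow>
      eps s u * ((A s * \<rho>' t s) * (B u * \<rho> t u)) + eps s u * ((A s * \<rho> t s) * (B u * \<rho>' t u)))" for t z
  have "((\<lambda>t. \<integral>z. F t z \<partial>(lborel \<Otimes>\<^sub>M lborel)) has_field_derivative
      (\<integral>z. F' t0 z \<partial>(lborel \<Otimes>\<^sub>M lborel))) (at t0)"
  proof (rule leibniz_rule_lebesgue_field_derivative[OF d])
    fix t assume t: "t \<in> ball t0 d"
    show "integrable (lborel \<Otimes>\<^sub>M lborel) (F t)"
      unfolding F_def by (rule integrable_eps_product[OF A\<rho> B\<rho>]) (use t in auto)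
    fix z :: "real \<times> real"
    obtain s u where z: "z = (s, u)" by force
    show "((\<lambda>t. F t z) has_field_derivative F' t z) (at t)"
      unfolding F_def F'_def z using der[OF t]
      by (auto intro!: derivative_eq_intros simp: algebra_simps)
    have "norm (F' t z) \<le> norm (eps s u) * (norm (A s) * norm (\<rho>' t s) * (norm (B u) * norm (\<rho> t u)))
        + norm (eps s u) * (norm (A s) * norm (\<rho> t s) * (norm (B u) * norm (\<rho>' t u)))"
      unfolding F'_def z prod.case by (rule order_trans[OF norm_triangle_ineq]) (simp add: norm_mult)
    also have "\<dots> \<le> 1 * (norm (A s) * K * (norm (B u) * K)) + 1 * (norm (A s) * K * (norm (B u) * K))"
      using norm_eps_le bound[OF t] K by (intro add_mono mult_mono) auto
    also have "\<dots> = 2 * K\<^sup>2 * (norm (A s) * norm (B u))"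
      by (simp add: power2_eq_square algebra_simps)
    finally show "norm (F' t z) \<le> 2 * K\<^sup>2 * (case z of (s, u) \<Rightarrow> norm (A s) * norm (B u))"
      by (simp add: z)
  next
    show "integrable (lborel \<Otimes>\<^sub>M lborel) (\<lambda>z. 2 * K\<^sup>2 * (case z of (s, u) \<Rightarrow> norm (A s) * norm (B u)))"
      by (intro integrable_mult_right integrable_norm_product A B)
    show "F' t0 \<in> borel_measurable (lborel \<Otimes>\<^sub>M lborel)"
      unfolding F'_def by measurable
  qed
  moreover have "(\<integral>z. F' t0 z \<partial>(lborel \<Otimes>\<^sub>M lborel)) =
      eps_form (\<lambda>s. A s * \<rho>' t0 s) (\<lambda>s. B s * \<rho> t0 s) + eps_form (\<lambda>s. A s * \<rho> t0 s) (\<lambda>s. B s * \<rho>' t0 s)"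
    unfolding F'_def eps_form_eq_product_integral[OF A\<rho>' B\<rho>[OF t0]]
        eps_form_eq_product_integral[OF A\<rho>[OF t0] B\<rho>']
    using integrable_eps_product[OF A\<rho>' B\<rho>[OF t0]] integrable_eps_product[OF A\<rho>[OF t0] B\<rho>']
    by (subst Bochner_Integration.integral_add[symmetric]) (auto simp: case_prod_unfold)
  ultimately have "((\<lambda>t. \<integral>z. F t z \<partial>(lborel \<Otimes>\<^sub>M lborel)) has_field_derivative
      (eps_form (\<lambda>s. A s * \<rho>' t0 s) (\<lambda>s. B s * \<rho> t0 s) + eps_form (\<lambda>s. A s * \<rho> t0 s)
          (\<lambda>s. B s * \<rho>' t0 s))) (at t0)"
    by simp
  then show ?thesis
  proof (rule has_field_derivative_transform_within[OF _ d UNIV_I])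
    fix t assume "dist t t0 < d"
    then have "t \<in> ball t0 d" by (simp add: dist_commute)
    then show "(\<integral>z. F t z \<partial>(lborel \<Otimes>\<^sub>M lborel)) = eps_form (\<lambda>s. A s * \<rho> t s) (\<lambda>s. B s * \<rho> t s)"
      unfolding F_def by (simp add: eps_form_eq_product_integral[OF A\<rho> B\<rho>])
  qed
qed

section \<open>Integrals along deformed half lines\<close>

lemma lipschitz_vector_derivative_bound:
  fixes f :: "real \<Rightarrow> 'a::real_normed_vector"
  assumes lip: "C-lipschitz_on {0..} f" and s: "0 < s" and der: "(f has_vector_derivative D) (at s)"
  shows "norm D \<le> C"
proof (rule field_le_epsilon)
  fix e :: real assume "0 < e"
  with der obtain d where d: "0 < d" and
    approx: "\<And>y. norm (y - s) < d \<Longrightarrow> norm (f y - f s - (y - s) *\<^sub>R D) \<le> e * norm (y - s)"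
    unfolding has_vector_derivative_def has_derivative_at_alt by blast
  define h where "h = d / 2"
  have h: "0 < h" "h < d" using d by (auto simp: h_def)
  have "norm (f (s + h) - f s) \<le> C * h"
    using lipschitz_onD[OF lip, of "s + h" s] s h by (simp add: dist_norm)
  moreover have "norm (f (s + h) - f s - h *\<^sub>R D) \<le> e * h"
    using approx[of "s + h"] h by simp
  moreover have "norm (h *\<^sub>R D) \<le> norm (f (s + h) - f s) + norm (f (s + h) - f s - h *\<^sub>R D)"
    by (metis norm_minus_commute norm_triangle_sub add.commute)
  ultimately have "h * norm D \<le> h * (C + e)" using h by (simp add: algebra_simps)
  then show "norm D \<le> C + e" using h by simp
qed

lemma integral_initial_segment_eq_increment:
  fixes G g :: "real \<Rightarrow> complex"
  assumes S: "finite S" and cont: "continuous_on {0..} G"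
    and der: "\<And>s. 0 < s \<Longrightarrow> s \<notin> S \<Longrightarrow> (G has_vector_derivative g s) (at s)"
    and int: "integrable lborel g" and zero: "\<And>s. s \<le> 0 \<Longrightarrow> g s = 0"
    and y: "0 \<le> y"
  shows "(LINT s|lborel. indicator {..y} s *\<^sub>R g s) = G y - G 0"
proof -
  have "set_integrable lborel {0..y} g"
    unfolding set_integrable_def using int by (intro integrable_mult_indicator) auto
  then have "(LINT s:{0..y}|lborel. g s) = integral {0..y} g"
    by (rule set_borel_integral_eq_integral)
  also have "\<dots> = G y - G 0"
    using S y der cont
    by (intro integral_unique fundamental_theorem_of_calculus_interior_strong[of S])
       (auto intro: continuous_on_subset)
  also have "(LINT s:{0..y}|lborel. g s) = (LINT s|lborel. indicator {..y} s *\<^sub>R g s)"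
    unfolding set_lebesgue_integral_def
  proof (intro Bochner_Integration.integral_cong refl)
    fix s :: real
    show "indicator {0..y} s *\<^sub>R g s = indicator {..y} s *\<^sub>R g s"
      by (cases "0 \<le> s") (simp_all add: indicator_def zero)
  qed
  finally show ?thesis .
qed

text \<open>Convolution with \<open>sgn / 2\<close> inverts differentiation: half the increment of \<open>G\<close> up to \<open>s\<close>
  minus half the increment beyond \<open>s\<close> is \<open>G s\<close>, because \<open>G\<close> vanishes at both ends.\<close>

lemma eps_transform_derivative:
  fixes G g :: "real \<Rightarrow> complex"
  assumes S: "finite S" and cont: "continuous_on {0..} G"
    and der: "\<And>s. 0 < s \<Longrightarrow> s \<notin> S \<Longrightarrow> (G has_vector_derivative g s) (at s)"
    and int: "integrable lborel g" and zero: "\<And>s. s \<le> 0 \<Longrightarrow> g s = 0"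
    and G0: "G 0 = 0" and lim: "(G \<longlongrightarrow> 0) at_top" and s: "0 \<le> s"
  shows "eps_transform g s = G s"
proof -
  have initial: "(LINT s|lborel. indicator {..y} s *\<^sub>R g s) = G y" if "0 \<le> y" for y
    using integral_initial_segment_eq_increment[OF S cont der int zero that] G0 by simp
  have "((\<lambda>y. LINT s|lborel. indicator {..y} s *\<^sub>R g s) \<longlongrightarrow> (LINT s|lborel. g s)) at_top"
    by (rule tendsto_integral_at_top) (use int in auto)
  moreover have "((\<lambda>y. LINT s|lborel. indicator {..y} s *\<^sub>R g s) \<longlongrightarrow> 0) at_top"
    by (rule Lim_transform_eventually[OF lim])
       (auto intro!: eventually_mono[OF eventually_ge_at_top[of 0]] simp: initial)
  ultimately have total: "(LINT s|lborel. g s) = 0"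
    using tendsto_unique trivial_limit_at_top_linorder by blast
  \<comment> \<open>Almost everywhere the kernel is the indicator of \<open>{..s}\<close> minus one half.\<close>
  have "eps_transform g s = (LINT u|lborel. indicator {..s} u *\<^sub>R g u - g u / 2)"
    unfolding eps_transform_def
  proof (rule integral_discrete_difference[of "{s}"])
    fix u :: real assume "u \<notin> {s}"
    then show "eps s u * g u = indicator {..s} u *\<^sub>R g u - g u / 2"
      by (auto simp: eps_def indicator_def sgn_if field_simps)
  qed auto
  also have "\<dots> = (LINT u|lborel. indicator {..s} u *\<^sub>R g u) - (LINT u|lborel. g u) / 2"
    using int by (subst Bochner_Integration.integral_diff) (auto intro: integrable_mult_indicator)
  finally show ?thesis using initial[OF s] total by simp
qed

text \<open>The derivative of the path, set to zero off the open half line and at its corners. This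
  changes the integrand only on a null set, and it makes the function bounded everywhere and
  makes the values of the path at negative parameters irrelevant.\<close>

definition path_deriv :: "(real \<Rightarrow> complex) \<Rightarrow> real \<Rightarrow> complex" where
  "path_deriv \<gamma> s = (if 0 < s \<and> \<gamma> differentiable (at s) then vector_derivative \<gamma> (at s) else 0)"

lemma path_deriv_nonpos: "s \<le> 0 \<Longrightarrow> path_deriv \<gamma> s = 0"
  by (simp add: path_deriv_def)

lemma norm_powr_of_real: "z \<noteq> 0 \<Longrightarrow> norm (z powr of_real \<alpha> :: complex) = norm z powr \<alpha>"
  by (simp add: powr_def)

context
  fixes \<gamma> :: "real \<Rightarrow> complex"
  assumes path: "half_line_path \<gamma>"
begin

lemma half_line_path_continuous: "continuous_on {0..} \<gamma>"
  using path by (auto simp: half_line_path_def piecewise_C1_differentiable_on_def)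

lemma half_line_path_at_0: "\<gamma> 0 = 0"
  using path by (simp add: half_line_path_def)

lemma half_line_path_off_cut: "0 < s \<Longrightarrow> \<gamma> s \<notin> \<real>\<^sub>\<le>\<^sub>0"
  using path by (simp add: half_line_path_def)

lemma half_line_path_nonzero: "0 < s \<Longrightarrow> \<gamma> s \<noteq> 0"
  using half_line_path_off_cut[of s] by auto

lemma continuous_on_half_line_path_powr: "continuous_on {0<..} (\<lambda>s. \<gamma> s powr a)"
proof (rule continuous_on_powr_complex)
  show "{0<..} \<subseteq> {s. 0 \<le> Re (\<gamma> s) \<or> Im (\<gamma> s) \<noteq> 0}"
    using half_line_path_off_cut by (force simp: complex_nonpos_Reals_iff)
qed (use half_line_path_nonzero half_line_path_continuous in
      \<open>auto intro: continuous_on_subset\<close>)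

lemma half_line_path_eventually_real:
  obtains R where "0 < R" "\<And>s. R \<le> s \<Longrightarrow> \<gamma> s = of_real s"
proof -
  from path obtain R where R: "\<And>s. R \<le> s \<Longrightarrow> \<gamma> s = of_real s"
    by (auto simp: half_line_path_def)
  show ?thesis by (rule that[of "max R 1"]) (auto intro: R)
qed

lemma half_line_path_exceptional_set:
  obtains S where "finite S" "0 \<in> S" "continuous_on ({0..} - S) (path_deriv \<gamma>)"
    "\<And>s. 0 \<le> s \<Longrightarrow> s \<notin> S \<Longrightarrow> path_deriv \<gamma> s = vector_derivative \<gamma> (at s)"
    "\<And>s. 0 \<le> s \<Longrightarrow> s \<notin> S \<Longrightarrow> (\<gamma> has_vector_derivative path_deriv \<gamma> s) (at s)"
proof -
  from path obtain S where S: "finite S" and "\<gamma> C1_differentiable_on ({0..} - S)"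
    unfolding half_line_path_def piecewise_C1_differentiable_on_def by (elim conjE exE)
  then obtain D where D: "\<And>s. s \<in> {0..} - S \<Longrightarrow> (\<gamma> has_vector_derivative D s) (at s)"
    and cont: "continuous_on ({0..} - S) D"
    unfolding C1_differentiable_on_def by blast
  have eq: "path_deriv \<gamma> s = D s" "vector_derivative \<gamma> (at s) = D s" if "0 \<le> s" "s \<notin> insert 0 S" for s
    using D[of s] that by (auto simp: path_deriv_def vector_derivative_at differentiableI_vector)
  show ?thesis
  proof (rule that[of "insert 0 S"])
    have "continuous_on ({0..} - insert 0 S) D"
      using cont by (rule continuous_on_subset) auto
    then show "continuous_on ({0..} - insert 0 S) (path_deriv \<gamma>)"
      by (rule continuous_on_eq) (auto simp: eq)
  qed (use S D eq in auto)
qed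

lemma measurable_path_deriv[measurable]: "path_deriv \<gamma> \<in> borel_measurable borel"
proof -
  obtain S where S: "finite S" "continuous_on ({0..} - S) (path_deriv \<gamma>)"
    by (rule half_line_path_exceptional_set) blast
  have "(\<lambda>s. indicator ({0..} - S) s *\<^sub>R path_deriv \<gamma> s) \<in> borel_measurable borel"
  proof (rule borel_measurable_continuous_on_indicator[OF _ S(2)])
    have "S \<in> sets borel" using S(1) by (intro borel_closed finite_imp_closed)
    then show "{0..} - S \<in> sets borel" by (intro sets.Diff) auto
  qed
  then show ?thesis
  proof (rule measurable_discrete_difference[where X = S])
    show "countable S" using S(1) by (rule countable_finite)
    show "indicator ({0..} - S) s *\<^sub>R path_deriv \<gamma> s = path_deriv \<gamma> s" if "s \<notin> S" for s
      using that by (simp add: indicator_def path_deriv_nonpos)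
  qed simp_all
qed

lemma path_deriv_bounded: obtains C where "0 \<le> C" "\<And>s. norm (path_deriv \<gamma> s) \<le> C"
proof -
  from path obtain C where C: "C-lipschitz_on {0..} \<gamma>" by (auto simp: half_line_path_def)
  have "0 \<le> C" using C by (rule lipschitz_on_nonneg)
  moreover have "norm (path_deriv \<gamma> s) \<le> C" for s
    using lipschitz_vector_derivative_bound[OF C] \<open>0 \<le> C\<close>
    by (auto simp: path_deriv_def vector_derivative_works)
  ultimately show ?thesis by (rule that)
qed

lemma path_int_eq: "path_int \<gamma> F = (LINT s|lborel. F s * path_deriv \<gamma> s)"
  and set_integrable_path_iff:
    "set_integrable lborel {0..} (\<lambda>s. F s * vector_derivative \<gamma> (at s))
      \<longleftrightarrow> integrable lborel (\<lambda>s. F s * path_deriv \<gamma> s)"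
proof -
  obtain S where S: "finite S" "0 \<in> S"
    "\<And>s. 0 \<le> s \<Longrightarrow> s \<notin> S \<Longrightarrow> path_deriv \<gamma> s = vector_derivative \<gamma> (at s)"
    by (rule half_line_path_exceptional_set) blast
  have eq: "indicator {0..} s *\<^sub>R (F s * vector_derivative \<gamma> (at s)) = F s * path_deriv \<gamma> s"
    if "s \<notin> S" for s
    using S(3)[of s] that by (auto simp: indicator_def path_deriv_nonpos)
  show "path_int \<gamma> F = (LINT s|lborel. F s * path_deriv \<gamma> s)"
    unfolding path_int_def set_lebesgue_integral_def
    by (rule integral_discrete_difference[of S]) (use S eq in \<open>auto intro: countable_finite\<close>)
  show "set_integrable lborel {0..} (\<lambda>s. F s * vector_derivative \<gamma> (at s))
      \<longleftrightarrow> integrable lborel (\<lambda>s. F s * path_deriv \<gamma> s)"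
    unfolding set_integrable_def
    by (rule integrable_discrete_difference[of S]) (use S eq in \<open>auto intro: countable_finite\<close>)
qed

lemma measurable_mult_path_deriv:
  assumes "continuous_on {0<..} F"
  shows "(\<lambda>s. F s * path_deriv \<gamma> s) \<in> borel_measurable borel"
proof -
  have [measurable]: "(\<lambda>s. indicator {0<..} s *\<^sub>R F s) \<in> borel_measurable borel"
    using assms by (intro borel_measurable_continuous_on_indicator) auto
  have "(\<lambda>s. (indicator {0<..} s *\<^sub>R F s) * path_deriv \<gamma> s) \<in> borel_measurable borel"
    by measurable
  also have "(\<lambda>s. (indicator {0<..} s *\<^sub>R F s) * path_deriv \<gamma> s) = (\<lambda>s. F s * path_deriv \<gamma> s)"
    by (auto simp: indicator_def path_deriv_nonpos fun_eq_iff)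
  finally show ?thesis .
qed

text \<open>Beyond some parameter \<open>T\<close> the path is the real axis, where the rate \<open>a > 1\<close> leaves room
  for a power; before \<open>T\<close> it stays in a compact set.\<close>

lemma half_line_path_exp_decay:
  assumes \<beta>: "0 \<le> \<beta>" and a: "1 < a"
  obtains B where "\<And>s. 0 < s \<Longrightarrow> norm (\<gamma> s) powr \<beta> * exp (- (a * Re (\<gamma> s))) \<le> B * exp (- s)"
proof -
  obtain R where R: "0 < R" "\<And>s. R \<le> s \<Longrightarrow> \<gamma> s = of_real s"
    by (rule half_line_path_eventually_real) blast
  have "((\<lambda>s. s powr \<beta> * exp (- ((a - 1) * s))) \<longlongrightarrow> 0) at_top"
    using a by real_asymp
  then have "\<forall>\<^sub>F s in at_top. s powr \<beta> * exp (- ((a - 1) * s)) < 1"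
    by (rule order_tendstoD) simp
  then obtain R1 where R1: "\<And>s. R1 \<le> s \<Longrightarrow> s powr \<beta> * exp (- ((a - 1) * s)) < 1"
    by (auto simp: eventually_at_top_linorder)
  define T where "T = max R R1"
  have "compact (\<gamma> ` {0..T})"
    by (intro compact_continuous_image continuous_on_subset[OF half_line_path_continuous]) auto
  then obtain K where K: "\<And>s. s \<in> {0..T} \<Longrightarrow> norm (\<gamma> s) \<le> K"
    using compact_imp_bounded bounded_iff by (metis (no_types, lifting) image_eqI)
  have T: "0 < T" using R by (simp add: T_def)
  have K0: "0 \<le> K" using K[of 0] T norm_ge_zero order_trans by (metis atLeastAtMost_iff less_eq_real_def)
  define B where "B = max 1 (K powr \<beta> * exp (a * K) * exp T)"
  have "norm (\<gamma> s) powr \<beta> * exp (- (a * Re (\<gamma> s))) \<le> B * exp (- s)" if s: "0 < s" for s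
  proof (cases "T \<le> s")
    case True
    then have "\<gamma> s = of_real s" "s powr \<beta> * exp (- ((a - 1) * s)) < 1"
      using R(2) R1 by (auto simp: T_def)
    moreover have "s powr \<beta> * exp (- (a * s)) = (s powr \<beta> * exp (- ((a - 1) * s))) * exp (- s)"
      by (simp add: mult.assoc algebra_simps flip: exp_add)
    moreover have "\<dots> \<le> B * exp (- s)"
      using calculation(2) by (intro mult_right_mono) (auto simp: B_def)
    ultimately show ?thesis using s by simp
  next
    case False
    then have n: "norm (\<gamma> s) \<le> K" using K s by simp
    have "norm (\<gamma> s) powr \<beta> * exp (- (a * Re (\<gamma> s))) \<le> K powr \<beta> * exp (a * K)"
    proof (intro mult_mono powr_mono2 \<beta> n)
      have "- Re (\<gamma> s) \<le> K" using n abs_Re_le_cmod[of "\<gamma> s"] by linarith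
      then have "a * (- Re (\<gamma> s)) \<le> a * K" using a by (intro mult_left_mono) auto
      then show "exp (- (a * Re (\<gamma> s))) \<le> exp (a * K)" by simp
    qed auto
    also have "\<dots> \<le> K powr \<beta> * exp (a * K) * (exp T * exp (- s))"
    proof -
      have "1 \<le> exp T * exp (- s)" using False by (simp flip: exp_add)
      then show ?thesis using mult_left_mono[of 1 "exp T * exp (- s)" "K powr \<beta> * exp (a * K)"] by simp
    qed
    also have "\<dots> \<le> B * exp (- s)"
      unfolding mult.assoc[symmetric] by (intro mult_right_mono) (auto simp: B_def)
    finally show ?thesis .
  qed
  then show ?thesis by (rule that)
qed

lemma half_line_path_poly_exp_decay:
  fixes p :: "complex poly"
  assumes \<alpha>: "0 \<le> \<alpha>" and a: "1 < a"
  obtains B where "\<And>s. 0 < s \<Longrightarrow>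
    norm (poly p (\<gamma> s) * exp (- (of_real a * \<gamma> s)) * \<gamma> s powr of_real \<alpha>) \<le> B * exp (- s)"
proof -
  have "\<exists>B. \<forall>s>0. norm (\<gamma> s) powr (real i + \<alpha>) * exp (- (a * Re (\<gamma> s))) \<le> B * exp (- s)" for i :: nat
    by (rule half_line_path_exp_decay[of "real i + \<alpha>" a]) (use \<alpha> a in auto)
  then obtain B where B: "\<And>i s. 0 < s \<Longrightarrow>
      norm (\<gamma> s) powr (real i + \<alpha>) * exp (- (a * Re (\<gamma> s))) \<le> B i * exp (- s)"
    by metis
  show ?thesis
  proof (rule that)
    fix s :: real assume s: "0 < s"
    have nz: "\<gamma> s \<noteq> 0" using half_line_path_nonzero[OF s] .
    have "norm (poly p (\<gamma> s) * exp (- (of_real a * \<gamma> s)) * \<gamma> s powr of_real \<alpha>)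
        = norm (poly p (\<gamma> s)) * (exp (- (a * Re (\<gamma> s))) * norm (\<gamma> s) powr \<alpha>)"
      using nz by (simp add: norm_mult norm_powr_of_real mult.assoc)
    also have "\<dots> \<le> (\<Sum>i\<le>degree p. norm (coeff p i) * norm (\<gamma> s) ^ i) *
        (exp (- (a * Re (\<gamma> s))) * norm (\<gamma> s) powr \<alpha>)"
      unfolding poly_altdef by (intro mult_right_mono order_trans[OF norm_sum])
          (auto simp: norm_mult norm_power)
    also have "\<dots> = (\<Sum>i\<le>degree p. norm (coeff p i) *
        (norm (\<gamma> s) powr (real i + \<alpha>) * exp (- (a * Re (\<gamma> s)))))"
      unfolding sum_distrib_right
      by (intro sum.cong) (use nz in \<open>auto simp: powr_add powr_realpow\<close>)
    also have "\<dots> \<le> (\<Sum>i\<le>degree p. norm (coeff p i) * (B i * exp (- s)))"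
      by (intro sum_mono mult_left_mono B s) auto
    also have "\<dots> = (\<Sum>i\<le>degree p. norm (coeff p i) * B i) * exp (- s)"
      by (simp add: sum_distrib_right mult.assoc)
    finally show "norm (poly p (\<gamma> s) * exp (- (of_real a * \<gamma> s)) * \<gamma> s powr of_real \<alpha>)
        \<le> (\<Sum>i\<le>degree p. norm (coeff p i) * B i) * exp (- s)" .
  qed
qed

lemma integrable_poly_exp_path:
  fixes p :: "complex poly" and h :: "real \<Rightarrow> complex"
  assumes \<alpha>: "0 \<le> \<alpha>" and a: "1 < a"
    and h: "continuous_on {0<..} h" "\<And>s. 0 < s \<Longrightarrow> norm (h s) \<le> K"
  shows "integrable lborel (\<lambda>s. poly p (\<gamma> s) * exp (- (of_real a * \<gamma> s)) * \<gamma> s powr of_real \<alpha> * h s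
    * path_deriv \<gamma> s)"
proof -
  obtain B where B: "\<And>s. 0 < s \<Longrightarrow>
      norm (poly p (\<gamma> s) * exp (- (of_real a * \<gamma> s)) * \<gamma> s powr of_real \<alpha>) \<le> B * exp (- s)"
    by (rule half_line_path_poly_exp_decay[OF \<alpha> a]) blast
  obtain C where C: "0 \<le> C" "\<And>s. norm (path_deriv \<gamma> s) \<le> C" by (rule path_deriv_bounded) blast
  have K: "0 \<le> K" using h(2)[of 1] norm_ge_zero[of "h 1"] by linarith
  have "set_integrable lborel {0<..} (\<lambda>s::real. exp (- s))"
    using integrable_I0i_exp_mscale[of 1] by simp
  then have "integrable lborel (\<lambda>s. (B * K * C) * (indicator {0<..} s * exp (- s :: real)))"
    unfolding set_integrable_def by (intro integrable_mult_right) simp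
  then show ?thesis
  proof (rule Bochner_Integration.integrable_bound)
    have "continuous_on {0<..} \<gamma>"
      by (rule continuous_on_subset[OF half_line_path_continuous]) auto
    then show "(\<lambda>s. poly p (\<gamma> s) * exp (- (of_real a * \<gamma> s)) * \<gamma> s powr of_real \<alpha> * h s * path_deriv \<gamma> s)
        \<in> borel_measurable lborel"
      by (simp, intro measurable_mult_path_deriv continuous_on_mult
          continuous_on_half_line_path_powr h(1))
         (auto intro!: continuous_intros)
    show "AE s in lborel. norm (poly p (\<gamma> s) * exp (- (of_real a * \<gamma> s)) * \<gamma> s powr of_real \<alpha> * h s
        * path_deriv \<gamma> s)
        \<le> norm ((B * K * C) * (indicator {0<..} s * exp (- s)))"
    proof (rule AE_I2)
      fix s :: real
      show "norm (poly p (\<gamma> s) * exp (- (of_real a * \<gamma> s)) * \<gamma> s powr of_real \<alpha> * h s * path_deriv \<gamma> s)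
        \<le> norm ((B * K * C) * (indicator {0<..} s * exp (- s)))"
      proof (cases "0 < s")
        case True
        have "norm (poly p (\<gamma> s) * exp (- (of_real a * \<gamma> s)) * \<gamma> s powr of_real \<alpha> * h s * path_deriv \<gamma> s)
          \<le> (B * exp (- s)) * K * C"
          unfolding norm_mult[of _ "path_deriv \<gamma> s"] norm_mult[of _ "h s"]
          using K C(1) order_trans[OF norm_ge_zero B[OF True]] by (intro mult_mono B True h(2) C(2)) auto
        also have "\<dots> \<le> norm ((B * K * C) * (indicator {0<..} s * exp (- s)))"
          using True by (simp add: algebra_simps)
        finally show ?thesis .
      qed (simp add: path_deriv_nonpos)
    qed
  qed
qed

end

text \<open>An entire function has a primitive \<open>F\<close>, so the integral up to the parameter \<open>y\<close> is \<open>F(\<gamma>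
  y) - F 0\<close>. Two admissible paths agree for large \<open>y\<close>, hence so do the limits.\<close>

lemma entire_integral_path_independent:
  assumes \<gamma>: "half_line_path \<gamma>" and \<delta>: "half_line_path \<delta>" and f: "f holomorphic_on UNIV"
    and int: "integrable lborel (\<lambda>s. f (\<gamma> s) * path_deriv \<gamma> s)"
      "integrable lborel (\<lambda>s. f (\<delta> s) * path_deriv \<delta> s)"
  shows "(LINT s|lborel. f (\<gamma> s) * path_deriv \<gamma> s) = (LINT s|lborel. f (\<delta> s) * path_deriv \<delta> s)"
proof -
  obtain F where F: "\<And>x. (F has_field_derivative f x) (at x)"
    using holomorphic_convex_primitive'[OF convex_UNIV open_UNIV f] by auto
  have initial: "(LINT s|lborel. indicator {..y} s *\<^sub>R (f (\<eta> s) * path_deriv \<eta> s)) = F (\<eta> y) - F 0"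
    if \<eta>: "half_line_path \<eta>" and int: "integrable lborel (\<lambda>s. f (\<eta> s) * path_deriv \<eta> s)" and y: "0
        \<le> y" for \<eta> y
  proof -
    obtain S where S: "finite S"
      "\<And>s. 0 \<le> s \<Longrightarrow> s \<notin> S \<Longrightarrow> (\<eta> has_vector_derivative path_deriv \<eta> s) (at s)"
      by (rule half_line_path_exceptional_set[OF \<eta>]) blast
    have "continuous_on UNIV F"
      using F by (auto intro: DERIV_isCont continuous_at_imp_continuous_on)
    then have "continuous_on {0..} (\<lambda>s. F (\<eta> s))"
      by (intro continuous_on_compose2[OF _ half_line_path_continuous[OF \<eta>]]) auto
    moreover have "((\<lambda>s. F (\<eta> s)) has_vector_derivative f (\<eta> s) * path_deriv \<eta> s) (at s)"
      if "0 < s" "s \<notin> S" for s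
      using field_vector_diff_chain_at[OF S(2)[of s] F] that by (simp add: o_def mult.commute)
    ultimately show ?thesis
      using integral_initial_segment_eq_increment[OF S(1), of "\<lambda>s. F (\<eta> s)" "\<lambda>s. f (\<eta> s)
          * path_deriv \<eta> s" y]
        int y half_line_path_at_0[OF \<eta>] by (simp add: path_deriv_nonpos)
  qed
  obtain R1 where R1: "0 < R1" "\<And>s. R1 \<le> s \<Longrightarrow> \<gamma> s = of_real s"
    by (rule half_line_path_eventually_real[OF \<gamma>]) blast
  obtain R2 where R2: "0 < R2" "\<And>s. R2 \<le> s \<Longrightarrow> \<delta> s = of_real s"
    by (rule half_line_path_eventually_real[OF \<delta>]) blast
  let ?I = "\<lambda>\<eta> y. LINT s|lborel. indicator {..y} s *\<^sub>R (f (\<eta> s) * path_deriv \<eta> s)"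
  have lim1: "(?I \<gamma> \<longlongrightarrow> (LINT s|lborel. f (\<gamma> s) * path_deriv \<gamma> s)) at_top"
    by (rule tendsto_integral_at_top) (use int in auto)
  have lim2: "(?I \<delta> \<longlongrightarrow> (LINT s|lborel. f (\<delta> s) * path_deriv \<delta> s)) at_top"
    by (rule tendsto_integral_at_top) (use int in auto)
  have "?I \<gamma> y = ?I \<delta> y" if "max R1 R2 \<le> y" for y
    using initial[OF \<gamma> int(1), of y] initial[OF \<delta> int(2), of y] R1 R2 that by simp
  then have "\<forall>\<^sub>F y in at_top. ?I \<gamma> y = ?I \<delta> y"
    by (rule eventually_at_top_linorderI)
  from Lim_transform_eventually[OF lim1 this] lim2 show ?thesis
    using tendsto_unique trivial_limit_at_top_linorder by blast
qed

lemma half_line_path_of_real: "half_line_path complex_of_real"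
  unfolding half_line_path_def
proof (intro conjI)
  have "complex_of_real C1_differentiable_on {0..}"
    unfolding C1_differentiable_on_def by (intro exI[of _ "\<lambda>_. 1"]) (auto intro!: derivative_eq_intros)
  then show "complex_of_real piecewise_C1_differentiable_on {0..}"
    by (rule C1_differentiable_imp_piecewise)
  show "\<exists>C. C-lipschitz_on {0..} complex_of_real"
    by (rule exI[of _ 1]) (auto simp: lipschitz_on_def dist_of_real)
qed (auto simp: inj_on_def)

lemma path_deriv_of_real: "path_deriv complex_of_real s = indicator {0<..} s"
proof -
  have "(complex_of_real has_vector_derivative 1) (at s)" by (auto intro!: derivative_eq_intros)
  then show ?thesis
    by (auto simp: path_deriv_def vector_derivative_at differentiableI_vector indicator_def)
qed

section \<open>The spiked weight on the path\<close>

text \<open>Near \<open>x\<close> the quotient \<open>r y / r x\<close> lies in the right half plane, so there \<open>r\<close> coincides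
  with \<open>r x * csqrt (w y / (r x)\<^sup>2)\<close>. The domain is a general normed space because the branch
  is differentiated both in the complex parameter \<open>t\<close> and along the real parameter of the
  path.\<close>

lemma continuous_sqrt_has_derivative:
  fixes r w :: "'a::real_normed_vector \<Rightarrow> complex"
  assumes cont: "continuous (at x) r" and sq: "\<forall>\<^sub>F y in nhds x. (r y)\<^sup>2 = w y"
    and nz: "r x \<noteq> 0" and der: "(w has_derivative D) (at x)"
  shows "(r has_derivative (\<lambda>h. D h / (2 * r x))) (at x)"
proof -
  have wx: "w x = (r x)\<^sup>2" using eventually_nhds_x_imp_x[OF sq] by simp
  have "((\<lambda>y. Re (r y / r x)) \<longlongrightarrow> Re (r x / r x)) (at x)"
    using cont nz by (intro tendsto_intros) (auto simp: isCont_def)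
  then have "((\<lambda>y. Re (r y / r x)) \<longlongrightarrow> Re (r x / r x)) (nhds x)"
    using tendsto_at_iff_tendsto_nhds[of "\<lambda>y. Re (r y / r x)" x] by simp
  then have "\<forall>\<^sub>F y in nhds x. 0 < Re (r y / r x)"
    using nz by (intro order_tendstoD) auto
  with sq have eq: "\<forall>\<^sub>F y in nhds x. r x * csqrt (w y / (r x)\<^sup>2) = r y"
  proof eventually_elim
    case (elim y)
    then have "csqrt ((r y / r x)\<^sup>2) = r y / r x" by (intro csqrt_square) auto
    with elim(1) nz show ?case by (simp add: power_divide)
  qed
  have "w x / (r x)\<^sup>2 = 1" using nz by (simp add: wx)
  then have csqrt: "(csqrt has_derivative (*) (1 / 2)) (at (w x / (r x)\<^sup>2))"
    using has_field_derivative_csqrt[of 1] by (simp add: has_field_derivative_def)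
  have "((\<lambda>y. w y / (r x)\<^sup>2) has_derivative (\<lambda>h. D h / (r x)\<^sup>2)) (at x)"
    using der by (auto intro!: derivative_eq_intros simp: divide_inverse)
  from has_derivative_compose[OF this csqrt]
  have "((\<lambda>y. csqrt (w y / (r x)\<^sup>2)) has_derivative (\<lambda>h. D h / (r x)\<^sup>2 * (1 / 2))) (at x)"
    by (simp add: mult.commute)
  then have "((\<lambda>y. r x * csqrt (w y / (r x)\<^sup>2)) has_derivative
      (\<lambda>h. r x * (D h / (r x)\<^sup>2 * (1 / 2)))) (at x)"
    by (rule has_derivative_mult_right)
  moreover have "(\<lambda>h. r x * (D h / (r x)\<^sup>2 * (1 / 2))) = (\<lambda>h. D h / (2 * r x))"
    using nz by (auto simp: power2_eq_square field_simps)
  ultimately have "((\<lambda>y. r x * csqrt (w y / (r x)\<^sup>2)) has_derivative (\<lambda>h. D h / (2 * r x))) (at x)"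
    by simp
  then show ?thesis
    by (rule has_derivative_transform_eventually)
       (use eq eventually_nhds_x_imp_x[OF eq] in \<open>auto simp: eventually_at_filter elim: eventually_mono\<close>)
qed

text \<open>In the following \<open>c\<close> is the value of \<open>tau_tilde\<close>. The bound on \<open>M\<close> makes the decay rate
  \<open>M / 2\<close> of the weight larger than \<open>1\<close>, as required by the estimates for path integrals.\<close>

locale spiked_weight =
  fixes M N :: nat and \<gamma> :: "real \<Rightarrow> complex" and c :: real and U :: "complex set"
    and rt :: "complex \<Rightarrow> complex \<Rightarrow> complex"
  assumes path: "half_line_path \<gamma>" and N_less_M: "N < M" and M_gt_2: "2 < M" and c_nonzero: "c \<noteq> 0"
    and open_U: "open U" and branch: "sqrt_branch c \<gamma> U rt"
begin

definition path_density :: "complex \<Rightarrow> complex poly \<Rightarrow> real \<Rightarrow> complex" where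
  "path_density t p s = poly p (\<gamma> s) * weight M N rt t (\<gamma> s) * path_deriv \<gamma> s"

definition pole_factor :: "complex \<Rightarrow> real \<Rightarrow> complex" where
  "pole_factor t s = 1 / (t - of_real c * \<gamma> s)"

definition exponent :: real where
  "exponent = (real M - real N - 1) / 2"

definition rate :: real where
  "rate = real M / 2"

lemma exponent_nonneg: "0 \<le> exponent"
  using N_less_M by (simp add: exponent_def)

lemma rate_gt_1: "1 < rate"
  using M_gt_2 by (simp add: rate_def)

lemma weight_eq: "weight M N rt t x = exp (- (of_real rate * x)) * x powr of_real exponent / rt t x"
  by (simp add: weight_def rate_def exponent_def)

lemma branch_square: "t \<in> U \<Longrightarrow> 0 \<le> s \<Longrightarrow> (rt t (\<gamma> s))\<^sup>2 = t - of_real c * \<gamma> s"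
  and path_avoids_pole: "t \<in> U \<Longrightarrow> 0 \<le> s \<Longrightarrow> t - of_real c * \<gamma> s \<noteq> 0"
  using branch by (auto simp: sqrt_branch_def)

lemma branch_nonzero: "t \<in> U \<Longrightarrow> 0 \<le> s \<Longrightarrow> rt t (\<gamma> s) \<noteq> 0"
  using branch_square[of t s] path_avoids_pole[of t s] by auto

lemma branch_continuous_param: "0 \<le> s \<Longrightarrow> continuous_on U (\<lambda>t. rt t (\<gamma> s))"
proof -
  assume s: "0 \<le> s"
  have "continuous_on U ((\<lambda>(t, x). rt t x) \<circ> (\<lambda>t. (t, \<gamma> s)))"
    using branch s unfolding sqrt_branch_def
    by (intro continuous_on_compose continuous_intros) (auto intro: continuous_on_subset)
  then show ?thesis by (simp add: o_def)
qed

lemma branch_continuous_path: "t \<in> U \<Longrightarrow> continuous_on {0..} (\<lambda>s. rt t (\<gamma> s))"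
proof -
  assume t: "t \<in> U"
  have "continuous_on {0..} ((\<lambda>(t, x). rt t x) \<circ> (\<lambda>s. (t, \<gamma> s)))"
    using branch t unfolding sqrt_branch_def
    by (intro continuous_on_compose continuous_intros half_line_path_continuous[OF path])
       (auto intro: continuous_on_subset)
  then show ?thesis by (simp add: o_def)
qed

text \<open>On a compact initial part the path keeps a positive distance from the zero \<open>t / c\<close> by
  compactness, and on the real tail \<open>\<bar>t - c x\<bar>\<close> tends to infinity as \<open>c \<noteq> 0\<close>.\<close>

lemma path_pole_distance:
  assumes t: "t \<in> U"
  obtains m where "0 < m" "\<And>s. 0 \<le> s \<Longrightarrow> m \<le> norm (t - of_real c * \<gamma> s)"
proof -
  obtain R where R: "0 < R" "\<And>s. R \<le> s \<Longrightarrow> \<gamma> s = of_real s"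
    by (rule half_line_path_eventually_real[OF path]) blast
  define T where "T = max R ((norm t + 1) / \<bar>c\<bar>)"
  have "continuous_on {0..T} (\<lambda>s. norm (t - of_real c * \<gamma> s))"
    by (intro continuous_intros continuous_on_subset[OF half_line_path_continuous[OF path]]) auto
  moreover have "{0..T} \<noteq> {}" using R(1) by (simp add: T_def)
  ultimately obtain s0 where s0: "s0 \<in> {0..T}"
    "\<And>s. s \<in> {0..T} \<Longrightarrow> norm (t - of_real c * \<gamma> s0) \<le> norm (t - of_real c * \<gamma> s)"
    using continuous_attains_inf[of "{0..T}" "\<lambda>s. norm (t - of_real c * \<gamma> s)"] by blast
  show ?thesis
  proof (rule that[of "min 1 (norm (t - of_real c * \<gamma> s0))"])
    show "0 < min 1 (norm (t - of_real c * \<gamma> s0))"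
      using path_avoids_pole[OF t, of s0] s0(1) by simp
    fix s :: real assume s: "0 \<le> s"
    show "min 1 (norm (t - of_real c * \<gamma> s0)) \<le> norm (t - of_real c * \<gamma> s)"
    proof (cases "s \<le> T")
      case True
      then show ?thesis using s0(2)[of s] s by simp
    next
      case False
      then have "\<gamma> s = of_real s" "(norm t + 1) / \<bar>c\<bar> \<le> s" using R(2) by (auto simp: T_def)
      then have "norm t + 1 \<le> norm (of_real c * \<gamma> s)"
        using c_nonzero s by (simp add: divide_le_eq norm_mult mult.commute)
      then have "1 \<le> norm (t - of_real c * \<gamma> s)"
        using norm_triangle_ineq2[of "of_real c * \<gamma> s" t] by (simp add: norm_minus_commute)
      then show ?thesis by simp
    qed
  qed
qed

lemma norm_inverse_branch_le:
  assumes "t \<in> U" "0 \<le> s" "0 < m" "m \<le> norm (t - of_real c * \<gamma> s)"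
  shows "norm (1 / rt t (\<gamma> s)) \<le> 1 / sqrt m"
proof -
  have "m \<le> (norm (rt t (\<gamma> s)))\<^sup>2"
    using assms(4) branch_square[OF assms(1,2)] by (simp flip: norm_power)
  then have "sqrt m \<le> norm (rt t (\<gamma> s))" by (intro real_le_lsqrt) (auto simp: assms(3) less_imp_le)
  then show ?thesis using assms(3) by (simp add: norm_divide frac_le)
qed

lemma norm_pole_factor_le:
  "0 < m \<Longrightarrow> m \<le> norm (t - of_real c * \<gamma> s) \<Longrightarrow> norm (pole_factor t s) \<le> 1 / m"
  by (simp add: pole_factor_def norm_divide frac_le)

lemma
  assumes t: "t \<in> U"
  shows integrable_density: "integrable lborel (path_density t p)"
    and integrable_density_pole_factor: "integrable lborel (\<lambda>s. path_density t p s * pole_factor t s)"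
proof -
  obtain m where m: "0 < m" "\<And>s. 0 \<le> s \<Longrightarrow> m \<le> norm (t - of_real c * \<gamma> s)"
    by (rule path_pole_distance[OF t]) blast
  have cont: "continuous_on {0<..} (\<lambda>s. 1 / rt t (\<gamma> s))"
    using branch_nonzero[OF t]
    by (intro continuous_intros continuous_on_subset[OF branch_continuous_path[OF t]]) auto
  have cont_pole: "continuous_on {0<..} (pole_factor t)"
    unfolding pole_factor_def using path_avoids_pole[OF t]
    by (intro continuous_intros continuous_on_subset[OF half_line_path_continuous[OF path]]) auto
  have bound: "norm (1 / rt t (\<gamma> s)) \<le> 1 / sqrt m" if "0 < s" for s
    using norm_inverse_branch_le[OF t _ m(1) m(2)] that by simp
  have "integrable lborel (\<lambda>s. poly p (\<gamma> s) * exp (- (of_real rate * \<gamma> s)) * \<gamma> s powr of_real exponent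
      * (1 / rt t (\<gamma> s)) * path_deriv \<gamma> s)"
    by (rule integrable_poly_exp_path[OF path exponent_nonneg rate_gt_1 cont bound])
  then show "integrable lborel (path_density t p)"
    by (rule back_subst[of "integrable lborel"]) (simp add: fun_eq_iff path_density_def weight_eq)
  have "integrable lborel (\<lambda>s. poly p (\<gamma> s) * exp (- (of_real rate * \<gamma> s)) * \<gamma> s powr of_real exponent
      * (1 / rt t (\<gamma> s) * pole_factor t s) * path_deriv \<gamma> s)"
  proof (rule integrable_poly_exp_path[OF path exponent_nonneg rate_gt_1])
    show "continuous_on {0<..} (\<lambda>s. 1 / rt t (\<gamma> s) * pole_factor t s)"
      by (intro continuous_on_mult cont cont_pole)
    show "norm (1 / rt t (\<gamma> s) * pole_factor t s) \<le> 1 / sqrt m * (1 / m)" if "0 < s" for s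
      unfolding norm_mult using that m
      by (intro mult_mono bound norm_pole_factor_le) auto
  qed
  then show "integrable lborel (\<lambda>s. path_density t p s * pole_factor t s)"
    by (rule back_subst[of "integrable lborel"]) (simp add: fun_eq_iff path_density_def weight_eq)
qed

lemma skew_prod_eq_eps_form:
  "skew_prod \<gamma> (weight M N rt t) (poly p) (poly q) = eps_form (path_density t p) (path_density t q)"
  unfolding skew_prod_def path_int_eq[OF path] eps_form_def eps_transform_def
proof (rule Bochner_Integration.integral_cong[OF refl])
  fix s
  have factor: "eps s u * poly p (\<gamma> s) * poly q (\<gamma> u) * weight M N rt t (\<gamma> s) * weight M N rt t
      (\<gamma> u) * path_deriv \<gamma> u
      = (poly p (\<gamma> s) * weight M N rt t (\<gamma> s)) * (eps s u * path_density t q u)" for u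
    by (simp add: path_density_def)
  show "(LINT u|lborel. eps s u * poly p (\<gamma> s) * poly q (\<gamma> u) * weight M N rt t (\<gamma> s)
        * weight M N rt t (\<gamma> u) * path_deriv \<gamma> u) * path_deriv \<gamma> s
      = path_density t p s * (LINT u|lborel. eps s u * path_density t q u)"
    unfolding factor by (simp add: path_density_def)
qed

lemma eps_op_eq_eps_transform:
  "eps_op \<gamma> (\<lambda>y. poly p y * weight M N rt t y) s = eps_transform (path_density t p) s"
  unfolding eps_op_def path_int_eq[OF path] eps_transform_def path_density_def by (simp add: mult.assoc)

lemma density_sum: "path_density t (\<Sum>i\<in>I. Polynomial.smult (a i) (p i)) s =
    (\<Sum>i\<in>I. a i * path_density t (p i) s)"
  by (simp add: path_density_def poly_sum sum_distrib_right mult.assoc)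

lemma eps_form_density_expansion:
  assumes t: "t \<in> U" and deg: "degree p < n" "degree q < n"
  shows "eps_form (path_density t p) (path_density t q) =
    (\<Sum>i<n. \<Sum>k<n. coeff p i * eps_form (path_density t (monom 1 i)) (path_density t (monom 1 k))
        * coeff q k)"
proof -
  have expand: "p = (\<Sum>i<n. Polynomial.smult (coeff p i) (monom 1 i))" if "degree p < n"
      for p :: "complex poly"
    using that by (auto simp: poly_eq_iff coeff_sum smult_monom sum.delta coeff_eq_0)
  have density: "path_density t p = (\<lambda>s. \<Sum>i<n. coeff p i * path_density t (monom 1 i) s)"
      if "degree p < n" for p
    by (subst expand[OF that]) (simp add: density_sum fun_eq_iff)
  have "eps_form (path_density t p) (path_density t q) =
      (\<Sum>i<n. coeff p i * eps_form (path_density t (monom 1 i)) (path_density t q))"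
    by (subst density[OF deg(1)]) (rule eps_form_sum_left[OF integrable_density[OF t]
        integrable_density[OF t]])
  also have "\<dots> = (\<Sum>i<n. coeff p i * (\<Sum>k<n. coeff q k * eps_form (path_density t (monom 1 i))
      (path_density t (monom 1 k))))"
    by (subst density[OF deg(2)]) (simp add: eps_form_sum_right[OF integrable_density[OF t]
        integrable_density[OF t]])
  finally show ?thesis by (simp add: sum_distrib_left mult_ac)
qed

lemma eps_form_density_swap:
  "t \<in> U \<Longrightarrow> eps_form (path_density t q) (path_density t p) = - eps_form (path_density t p)
      (path_density t q)"
  by (rule eps_form_swap[OF integrable_density integrable_density])

lemma eps_form_density_self: "t \<in> U \<Longrightarrow> eps_form (path_density t p) (path_density t p) = 0"
  using eps_form_density_swap[of t p p] by simp

section \<open>Dependence of the skew product on the parameter\<close>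

text \<open>The factor \<open>1 / rt t x\<close> has the \<open>t\<close>-derivative \<open>- 1 / (2 rt t x (t - c x))\<close>. It is
  uniformly bounded, with its derivative, on a ball around \<open>t0\<close> whose radius is at most half
  the distance from \<open>t0\<close> to the points \<open>c x\<close>, with \<open>x\<close> on the path. The term in which the
  second argument is differentiated is turned into the other by antisymmetry.\<close>

lemma eps_form_density_has_field_derivative:
  assumes t0: "t0 \<in> U"
  shows "((\<lambda>t. eps_form (path_density t p) (path_density t q)) has_field_derivative
    (eps_form (\<lambda>s. path_density t0 q s * pole_factor t0 s) (path_density t0 p)
     - eps_form (\<lambda>s. path_density t0 p s * pole_factor t0 s) (path_density t0 q)) / 2) (at t0)"
proof -
  obtain m where m: "0 < m" "\<And>s. 0 \<le> s \<Longrightarrow> m \<le> norm (t0 - of_real c * \<gamma> s)"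
    by (rule path_pole_distance[OF t0]) blast
  obtain e where e: "0 < e" "ball t0 e \<subseteq> U" using open_U t0 by (rule openE)
  define d where "d = min e (m / 2)"
  have d: "0 < d" using e m by (simp add: d_def)
  have ball: "t \<in> U" "\<And>s. 0 \<le> s \<Longrightarrow> m / 2 \<le> norm (t - of_real c * \<gamma> s)" if "t \<in> ball t0 d" for t
  proof -
    show "t \<in> U" using that e(2) by (auto simp: d_def)
    fix s :: real assume "0 \<le> s"
    then have "m \<le> norm (t0 - of_real c * \<gamma> s)" by (rule m)
    also have "\<dots> \<le> norm (t - of_real c * \<gamma> s) + norm (t0 - t)"
      using norm_triangle_ineq[of "t - of_real c * \<gamma> s" "t0 - t"] by simp
    finally show "m / 2 \<le> norm (t - of_real c * \<gamma> s)"
      using that by (simp add: d_def dist_norm)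
  qed
  \<comment> \<open>Nothing is known of the path at negative parameters; the value \<open>0\<close> there is harmless
    because \<open>path_deriv\<close> vanishes too.\<close>
  define \<rho> where "\<rho> t s = (if 0 < s then 1 / rt t (\<gamma> s) else 0)" for t s
  define \<rho>' where "\<rho>' t s = - (\<rho> t s * pole_factor t s) / 2" for t s
  define base where "base p s = poly p (\<gamma> s) * exp (- (of_real rate * \<gamma> s))
      * \<gamma> s powr of_real exponent * path_deriv \<gamma> s" for p s
  have base: "path_density t p s = base p s * \<rho> t s" for t p s
    by (auto simp: path_density_def base_def \<rho>_def weight_eq path_deriv_nonpos)
  have base_int: "integrable lborel (base p)" for p
  proof -
    have "integrable lborel (\<lambda>s. poly p (\<gamma> s) * exp (- (of_real rate * \<gamma> s))
        * \<gamma> s powr of_real exponent * 1 * path_deriv \<gamma> s)"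
      by (rule integrable_poly_exp_path[OF path exponent_nonneg rate_gt_1, of _ 1]) auto
    then show ?thesis by (rule back_subst[of "integrable lborel"]) (simp add: fun_eq_iff base_def)
  qed
  have meas: "\<rho> t \<in> borel_measurable borel" if "t \<in> U" for t
  proof -
    have "continuous_on {0<..} (\<lambda>s. 1 / rt t (\<gamma> s))"
      using branch_nonzero[OF that]
      by (intro continuous_intros continuous_on_subset[OF branch_continuous_path[OF that]]) auto
    then have "(\<lambda>s. indicator {0<..} s *\<^sub>R (1 / rt t (\<gamma> s))) \<in> borel_measurable borel"
      by (intro borel_measurable_continuous_on_indicator) auto
    then show ?thesis
      by (rule back_subst[of "\<lambda>f. f \<in> borel_measurable borel"])
          (auto simp: fun_eq_iff \<rho>_def indicator_def)
  qed
  have meas': "\<rho>' t0 \<in> borel_measurable borel"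
  proof -
    have "continuous_on {0<..} (\<lambda>s. - (1 / rt t0 (\<gamma> s) * pole_factor t0 s) / 2)"
      unfolding pole_factor_def using branch_nonzero[OF t0] path_avoids_pole[OF t0]
      by (intro continuous_intros continuous_on_subset[OF branch_continuous_path[OF t0]]
          continuous_on_subset[OF half_line_path_continuous[OF path]]) auto
    then have "(\<lambda>s. indicator {0<..} s *\<^sub>R (- (1 / rt t0 (\<gamma> s) * pole_factor t0 s) / 2))
        \<in> borel_measurable borel"
      by (intro borel_measurable_continuous_on_indicator) auto
    then show ?thesis
      by (rule back_subst[of "\<lambda>f. f \<in> borel_measurable borel"])
          (auto simp: fun_eq_iff \<rho>_def \<rho>'_def indicator_def)
  qed
  have der: "((\<lambda>t. \<rho> t s) has_field_derivative \<rho>' t s) (at t)" if t: "t \<in> ball t0 d" for t s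
  proof (cases "0 < s")
    case True
    then have s: "0 \<le> s" by simp
    have tU: "t \<in> U" using ball(1)[OF t] .
    have nz: "rt t (\<gamma> s) \<noteq> 0" using branch_nonzero[OF tU s] .
    have "\<forall>\<^sub>F z in nhds t. z \<in> U" using open_U tU by (rule eventually_nhds_in_open)
    then have "\<forall>\<^sub>F z in nhds t. (rt z (\<gamma> s))\<^sup>2 = z - of_real c * \<gamma> s"
      by eventually_elim (rule branch_square[OF _ s])
    moreover have "continuous (at t) (\<lambda>t. rt t (\<gamma> s))"
      using branch_continuous_param[OF s] open_U tU by (simp add: continuous_on_eq_continuous_at)
    moreover have "((\<lambda>z. z - of_real c * \<gamma> s) has_derivative (\<lambda>h. h)) (at t)"
      by (auto intro!: derivative_eq_intros)
    ultimately have "((\<lambda>t. rt t (\<gamma> s)) has_derivative (\<lambda>h. h / (2 * rt t (\<gamma> s)))) (at t)"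
      using nz by (intro continuous_sqrt_has_derivative[where r = "\<lambda>t. rt t (\<gamma> s)"])
    then have "((\<lambda>t. rt t (\<gamma> s)) has_field_derivative 1 / (2 * rt t (\<gamma> s))) (at t)"
      unfolding has_field_derivative_def by (rule has_derivative_eq_rhs) (simp add: fun_eq_iff)
    from DERIV_inverse_fun[OF this nz]
    have "((\<lambda>t. 1 / rt t (\<gamma> s)) has_field_derivative
        - (1 / rt t (\<gamma> s) * (1 / (2 * rt t (\<gamma> s))) * (1 / rt t (\<gamma> s)))) (at t)"
      by (simp add: inverse_eq_divide mult_ac)
    moreover have "- (1 / rt t (\<gamma> s) * (1 / (2 * rt t (\<gamma> s))) * (1 / rt t (\<gamma> s))) = \<rho>' t s"
      using True nz unfolding \<rho>'_def \<rho>_def pole_factor_def branch_square[OF tU s, symmetric]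
      by (simp add: power2_eq_square)
    ultimately show ?thesis using True by (simp add: \<rho>_def)
  qed (simp add: \<rho>_def \<rho>'_def)
  have bound_\<rho>: "norm (\<rho> t s) \<le> 1 / sqrt (m / 2)" if "t \<in> ball t0 d" for t s
    using norm_inverse_branch_le[OF ball(1)[OF that] _ _ ball(2)[OF that], of s] m by (auto simp: \<rho>_def)
  have bound_\<rho>': "norm (\<rho>' t s) \<le> 1 / sqrt (m / 2) * (1 / (m / 2))" if "t \<in> ball t0 d" for t s
  proof (cases "0 < s")
    case True
    have "norm (\<rho>' t s) \<le> norm (\<rho> t s) * norm (pole_factor t s)"
      by (simp add: \<rho>'_def norm_divide norm_mult)
    also have "\<dots> \<le> 1 / sqrt (m / 2) * (1 / (m / 2))"
      using True m ball(2)[OF that] by (intro mult_mono bound_\<rho> that norm_pole_factor_le) auto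
    finally show ?thesis .
  qed (use m in \<open>simp add: \<rho>'_def \<rho>_def\<close>)
  define K where "K = max (1 / sqrt (m / 2)) (1 / sqrt (m / 2) * (1 / (m / 2)))"
  have der_form: "((\<lambda>t. eps_form (\<lambda>s. base p s * \<rho> t s) (\<lambda>s. base q s * \<rho> t s)) has_field_derivative
     eps_form (\<lambda>s. base p s * \<rho>' t0 s) (\<lambda>s. base q s * \<rho> t0 s)
     + eps_form (\<lambda>s. base p s * \<rho> t0 s) (\<lambda>s. base q s * \<rho>' t0 s)) (at t0)"
  proof (rule eps_form_has_field_derivative[OF base_int base_int d])
    show "norm (\<rho> t s) \<le> K" if "t \<in> ball t0 d" for t s
      unfolding K_def by (rule max.coboundedI1[OF bound_\<rho>[OF that]])
    show "norm (\<rho>' t s) \<le> K" if "t \<in> ball t0 d" for t s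
      unfolding K_def by (rule max.coboundedI2[OF bound_\<rho>'[OF that]])
  qed (use meas meas' ball(1) der in auto)
  have \<rho>'_eq: "base p s * \<rho>' t0 s = (- 1 / 2) * (path_density t0 p s * pole_factor t0 s)" for p s
    by (simp add: base \<rho>'_def)
  have left: "eps_form (\<lambda>s. base p s * \<rho>' t0 s) (path_density t0 q) =
      - eps_form (\<lambda>s. path_density t0 p s * pole_factor t0 s) (path_density t0 q) / 2" for p q
  proof -
    have "eps_form (\<lambda>s. base p s * \<rho>' t0 s) (path_density t0 q) = (LINT s|lborel.
        (- 1 / 2) * (path_density t0 p s * pole_factor t0 s * eps_transform (path_density t0 q) s))"
      unfolding eps_form_def \<rho>'_eq mult.assoc ..
    then show ?thesis unfolding eps_form_def by simp
  qed
  have "integrable lborel (\<lambda>s. base q s * \<rho>' t0 s)"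
    unfolding \<rho>'_eq by (intro integrable_mult_right integrable_density_pole_factor t0)
  then have right: "eps_form (path_density t0 p) (\<lambda>s. base q s * \<rho>' t0 s) =
      eps_form (\<lambda>s. path_density t0 q s * pole_factor t0 s) (path_density t0 p) / 2"
    unfolding eps_form_swap[OF \<open>integrable lborel (\<lambda>s. base q s * \<rho>' t0 s)\<close> integrable_density[OF t0]]
    by (simp add: left)
  have "(\<lambda>s. base p s * \<rho> t s) = path_density t p" for t p
    by (simp add: fun_eq_iff base)
  then show ?thesis
    using der_form left[of p q] right by (simp add: diff_divide_distrib)
qed

section \<open>The skew product with a total derivative\<close>

text \<open>The polynomial \<open>D q\<close> with \<open>d/dx (q x (t - c x) w) = (D q) w\<close>: after multiplication by \<open>x
  (t - c x)\<close> the logarithmic derivative \<open>- M/2 + (M - N - 1)/(2 x) + c/(2 (t - c x))\<close> of \<open>w\<close>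
  turns into the polynomial terms below.\<close>

definition deriv_operator :: "complex \<Rightarrow> complex poly \<Rightarrow> complex poly" where
  "deriv_operator t q =
     (pCons 0 (pderiv q) - Polynomial.smult (of_real rate) (pCons 0 q) + Polynomial.smult
         (of_real (exponent + 1)) q)
       * [:t, - of_real c:] - Polynomial.smult (of_real c / 2) (pCons 0 q)"

lemma degree_deriv_operator:
  assumes "degree q < n" shows "degree (deriv_operator t q) < n + 2"
proof -
  let ?l = "pCons 0 (pderiv q) - Polynomial.smult (of_real rate) (pCons 0 q) + Polynomial.smult
      (of_real (exponent + 1)) q"
  have pC: "degree (pCons 0 q) \<le> degree q + 1" "degree (pCons 0 (pderiv q)) \<le> degree q + 1"
    by (auto intro: order_trans[OF degree_pCons_le] simp: degree_pderiv)
  have "degree ?l \<le> degree q + 1"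
    using pC by (intro degree_add_le degree_diff_le order_trans[OF degree_smult_le]) auto
  moreover have "degree [:t, - of_real c:] \<le> 1" by simp
  ultimately have "degree (?l * [:t, - of_real c:]) \<le> degree q + 1 + 1"
    by (intro order_trans[OF degree_mult_le] add_mono)
  moreover have "degree (Polynomial.smult (of_real c / 2 :: complex) (pCons 0 q)) \<le> degree q + 1 + 1"
    using pC(1) by (intro order_trans[OF degree_smult_le]) simp
  ultimately have "degree (deriv_operator t q) \<le> degree q + 1 + 1"
    unfolding deriv_operator_def by (rule degree_diff_le)
  then show ?thesis using assms by simp
qed

text \<open>The function \<open>q x (t - c x) w\<close> on the path. One factor \<open>x\<close> is absorbed in the power and
  \<open>(t - c x) / rt t x = rt t x\<close>; in this form it is visibly continuous, with value \<open>0\<close>, at the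
  starting point.\<close>

definition primitive :: "complex \<Rightarrow> complex poly \<Rightarrow> real \<Rightarrow> complex" where
  "primitive t q s = poly q (\<gamma> s) * exp (- (of_real rate * \<gamma> s)) * \<gamma> s powr of_real (exponent + 1)
      * rt t (\<gamma> s)"

lemma eps_transform_density_deriv_operator:
  assumes t: "t \<in> U" and s: "0 \<le> s"
  shows "eps_transform (path_density t (deriv_operator t q)) s = primitive t q s"
proof -
  obtain S where S: "finite S"
    "\<And>s. 0 \<le> s \<Longrightarrow> s \<notin> S \<Longrightarrow> (\<gamma> has_vector_derivative path_deriv \<gamma> s) (at s)"
    by (rule half_line_path_exceptional_set[OF path]) blast
  obtain m where m: "0 < m" "\<And>s. 0 \<le> s \<Longrightarrow> m \<le> norm (t - of_real c * \<gamma> s)"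
    by (rule path_pole_distance[OF t]) blast
  note cont_\<gamma> = half_line_path_continuous[OF path]
  show ?thesis
  proof (rule eps_transform_derivative[OF S(1) _ _ integrable_density[OF t] _ _ _ s])
    have "continuous_on {0..} (\<lambda>s. \<gamma> s powr of_real (exponent + 1))"
    proof (rule continuous_on_powr_complex[OF _ _ cont_\<gamma> continuous_on_const])
      show "{0..} \<subseteq> {s. 0 \<le> Re (\<gamma> s) \<or> Im (\<gamma> s) \<noteq> 0}"
        using half_line_path_off_cut[OF path] half_line_path_at_0[OF path]
        by (force simp: complex_nonpos_Reals_iff le_less)
    qed (use exponent_nonneg in auto)
    moreover have "continuous_on {0..} (\<lambda>s. poly q (\<gamma> s) * exp (- (of_real rate * \<gamma> s)))"
      using cont_\<gamma> by (auto intro!: continuous_intros)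
    ultimately show "continuous_on {0..} (primitive t q)"
      unfolding primitive_def by (metis (no_types) continuous_on_mult branch_continuous_path[OF t])
  next
    fix s :: real assume s: "0 < s" "s \<notin> S"
    then have s0: "0 \<le> s" by simp
    have \<gamma>: "(\<gamma> has_vector_derivative path_deriv \<gamma> s) (at s)" using S(2)[OF s0 s(2)] .
    have nz: "\<gamma> s \<noteq> 0" and cut: "\<gamma> s \<notin> \<real>\<^sub>\<le>\<^sub>0"
      using half_line_path_nonzero[OF path s(1)] half_line_path_off_cut[OF path s(1)] by auto
    have rt_nz: "rt t (\<gamma> s) \<noteq> 0" using branch_nonzero[OF t s0] .
    define E where "E x = poly q x * exp (- (of_real rate * x)) * x powr of_real (exponent + 1)"
        for x :: complex
    define E' where "E' = exp (- (of_real rate * \<gamma> s)) * \<gamma> s powr of_real exponent *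
        (poly (pderiv q) (\<gamma> s) * \<gamma> s - of_real rate * \<gamma> s * poly q (\<gamma> s) + of_real (exponent + 1)
            * poly q (\<gamma> s))"
    have powr: "\<gamma> s powr of_real (exponent + 1) = \<gamma> s powr of_real exponent * \<gamma> s"
      using nz by (simp add: powr_add)
    have "((\<lambda>x. x powr of_real (exponent + 1)) has_field_derivative
        of_real (exponent + 1) * \<gamma> s powr (of_real (exponent + 1) - 1)) (at (\<gamma> s))"
      by (rule has_field_derivative_powr[OF cut])
    then have dpowr: "((\<lambda>x. x powr of_real (exponent + 1)) has_field_derivative
        of_real (exponent + 1) * \<gamma> s powr of_real exponent) (at (\<gamma> s))"
      by simp
    have "((\<lambda>x. poly q x * exp (- (of_real rate * x))) has_field_derivative
        (poly (pderiv q) (\<gamma> s) - of_real rate * poly q (\<gamma> s)) * exp (- (of_real rate * \<gamma> s))) (at (\<gamma> s))"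
      by (auto intro!: derivative_eq_intros poly_DERIV simp: algebra_simps)
    from DERIV_mult[OF this dpowr] have "(E has_field_derivative E') (at (\<gamma> s))"
      unfolding E_def E'_def powr by (rule DERIV_cong) (simp add: algebra_simps)
    from field_vector_diff_chain_at[OF \<gamma> this]
    have dE: "((\<lambda>s. E (\<gamma> s)) has_vector_derivative path_deriv \<gamma> s * E') (at s)"
      by (simp add: o_def)
    have drt: "((\<lambda>s. rt t (\<gamma> s)) has_vector_derivative - of_real c * path_deriv \<gamma> s /
        (2 * rt t (\<gamma> s))) (at s)"
    proof -
      have "\<forall>\<^sub>F u in nhds s. u \<in> {0<..}" using s(1) by (intro eventually_nhds_in_open) auto
      then have "\<forall>\<^sub>F u in nhds s. (rt t (\<gamma> u))\<^sup>2 = t - of_real c * \<gamma> u"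
        by eventually_elim (auto intro!: branch_square[OF t])
      moreover have "continuous (at s) (\<lambda>s. rt t (\<gamma> s))"
      proof -
        have "continuous_on {0<..} (\<lambda>s. rt t (\<gamma> s))"
          by (rule continuous_on_subset[OF branch_continuous_path[OF t]]) auto
        then show ?thesis using s(1) by (simp add: continuous_on_eq_continuous_at)
      qed
      moreover have "((\<lambda>u. t - of_real c * \<gamma> u) has_derivative
          (\<lambda>h. - of_real c * (h *\<^sub>R path_deriv \<gamma> s))) (at s)"
        using \<gamma> unfolding has_vector_derivative_def by (auto intro!: derivative_eq_intros)
      ultimately have "((\<lambda>s. rt t (\<gamma> s)) has_derivative
          (\<lambda>h. - of_real c * (h *\<^sub>R path_deriv \<gamma> s) / (2 * rt t (\<gamma> s)))) (at s)"
        using rt_nz by (intro continuous_sqrt_has_derivative[where r = "\<lambda>s. rt t (\<gamma> s)"])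
      then show ?thesis
        unfolding has_vector_derivative_def
        by (rule has_derivative_eq_rhs) (simp add: fun_eq_iff scaleR_conv_of_real)
    qed
    have rt2: "t - of_real c * \<gamma> s = rt t (\<gamma> s) * rt t (\<gamma> s)"
      using branch_square[OF t s0] by (simp add: power2_eq_square)
    define l where "l = poly (pderiv q) (\<gamma> s) * \<gamma> s - of_real rate * \<gamma> s * poly q (\<gamma> s) + of_real
        (exponent + 1) * poly q (\<gamma> s)"
    have "poly (deriv_operator t q) (\<gamma> s) = l * (t - of_real c * \<gamma> s) - of_real c / 2 * \<gamma> s * poly q
        (\<gamma> s)"
      by (simp add: deriv_operator_def l_def algebra_simps)
    then have op: "poly (deriv_operator t q) (\<gamma> s) / rt t (\<gamma> s) =
        l * rt t (\<gamma> s) - of_real c * \<gamma> s * poly q (\<gamma> s) / (2 * rt t (\<gamma> s))"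
      unfolding rt2 using rt_nz by (simp add: field_simps)
    have "path_density t (deriv_operator t q) s = exp (- (of_real rate * \<gamma> s))
        * \<gamma> s powr of_real exponent
        * (poly (deriv_operator t q) (\<gamma> s) / rt t (\<gamma> s)) * path_deriv \<gamma> s"
      by (simp add: path_density_def weight_eq)
    also have "\<dots> = E (\<gamma> s) * (- of_real c * path_deriv \<gamma> s / (2 * rt t (\<gamma> s))) + path_deriv \<gamma> s * E'
        * rt t (\<gamma> s)"
      unfolding op E_def E'_def l_def[symmetric] powr by (simp add: algebra_simps)
    finally have density: "path_density t (deriv_operator t q) s =
        E (\<gamma> s) * (- of_real c * path_deriv \<gamma> s / (2 * rt t (\<gamma> s))) + path_deriv \<gamma> s * E' * rt t (\<gamma> s)" .
    have "primitive t q = (\<lambda>s. E (\<gamma> s) * rt t (\<gamma> s))"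
      by (simp add: fun_eq_iff primitive_def E_def)
    then show "(primitive t q has_vector_derivative path_density t (deriv_operator t q) s) (at s)"
      unfolding density using has_vector_derivative_mult[OF dE drt] by simp
  next
    show "path_density t (deriv_operator t q) s = 0" if "s \<le> 0" for s
      using that by (simp add: path_density_def path_deriv_nonpos)
    show "primitive t q 0 = 0"
      by (simp add: primitive_def half_line_path_at_0[OF path])
    obtain B where B: "\<And>s. 0 < s \<Longrightarrow>
        norm (poly (q * [:t, - of_real c:]) (\<gamma> s) * exp (- (of_real rate * \<gamma> s)) * \<gamma> s powr of_real
            (exponent + 1)) \<le> B * exp (- s)"
      using half_line_path_poly_exp_decay[OF path _ rate_gt_1, of "exponent + 1" "q
          * [:t, - of_real c:]"]
        exponent_nonneg by (metis add_nonneg_nonneg zero_le_one)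
    have bound: "norm (primitive t q s) \<le> B * exp (- s) * (1 / sqrt m)" if s: "0 < s" for s
    proof -
      have s0: "0 \<le> s" using s by simp
      have rt: "rt t (\<gamma> s) = (t - of_real c * \<gamma> s) * (1 / rt t (\<gamma> s))"
        using branch_square[OF t s0] branch_nonzero[OF t s0] by (simp add: power2_eq_square field_simps)
      have poly: "poly (q * [:t, - of_real c:]) (\<gamma> s) = poly q (\<gamma> s) * (t - of_real c * \<gamma> s)"
        by (simp add: algebra_simps)
      have "primitive t q s = poly q (\<gamma> s) * exp (- (of_real rate * \<gamma> s)) * \<gamma> s powr of_real
          (exponent + 1)
          * ((t - of_real c * \<gamma> s) * (1 / rt t (\<gamma> s)))"
        unfolding primitive_def by (rule arg_cong2[where f = "(*)", OF refl rt])
      also have "\<dots> = (poly (q * [:t, - of_real c:]) (\<gamma> s) * exp (- (of_real rate * \<gamma> s))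
          * \<gamma> s powr of_real (exponent + 1)) * (1 / rt t (\<gamma> s))"
        unfolding poly by (simp only: mult_ac)
      finally have "norm (primitive t q s) = norm
          (poly (q * [:t, - of_real c:]) (\<gamma> s) * exp (- (of_real rate * \<gamma> s)) * \<gamma> s powr of_real
          (exponent + 1)) * norm (1 / rt t (\<gamma> s))"
        by (simp only: norm_mult)
      also have "\<dots> \<le> B * exp (- s) * (1 / sqrt m)"
        using B[OF s] norm_inverse_branch_le[OF t s0 m(1) m(2)[OF s0]]
            order_trans[OF norm_ge_zero B[OF s]]
        by (intro mult_mono) auto
      finally show ?thesis .
    qed
    have "((\<lambda>s. B * exp (- s) * (1 / sqrt m)) \<longlongrightarrow> 0) at_top"
      by real_asymp
    then show "(primitive t q \<longlongrightarrow> 0) at_top"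
      by (rule Lim_null_comparison[rotated])
         (rule eventually_mono[OF eventually_gt_at_top[of 0] bound])
  qed
qed

definition laguerre_weight :: "real \<Rightarrow> real" where
  "laguerre_weight x = x ^ (M - N) * exp (- (real M * x))"

definition laguerre_functional :: "complex poly \<Rightarrow> complex" where
  "laguerre_functional p = (LINT x:{0<..}|lborel. poly p (of_real x) * of_real (laguerre_weight x))"

lemma integrable_entire_laguerre:
  assumes \<delta>: "half_line_path \<delta>"
  shows "integrable lborel (\<lambda>s. poly p (\<delta> s) * \<delta> s ^ (M - N) * exp (- (of_nat M * \<delta> s))
      * path_deriv \<delta> s)"
proof -
  have "integrable lborel (\<lambda>s. poly (p * monom 1 (M - N)) (\<delta> s) * exp (- (of_real (real M) * \<delta> s))
      * \<delta> s powr of_real 0 * 1 * path_deriv \<delta> s)"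
    by (rule integrable_poly_exp_path[OF \<delta>, of _ _ _ 1]) (use M_gt_2 in auto)
  moreover have "poly (p * monom 1 (M - N)) (\<delta> s) * exp (- (of_real (real M) * \<delta> s))
      * \<delta> s powr of_real 0 * 1 * path_deriv \<delta> s
      = poly p (\<delta> s) * \<delta> s ^ (M - N) * exp (- (of_nat M * \<delta> s)) * path_deriv \<delta> s" for s
    using half_line_path_nonzero[OF \<delta>, of s]
    by (cases "0 < s") (auto simp: poly_monom path_deriv_nonpos)
  ultimately show ?thesis by (simp only:)
qed

text \<open>The power \<open>M - N\<close> is a natural number, so the Laguerre weight is entire and the deformed
  path can be replaced by the half line.\<close>

lemma laguerre_functional_path:
  "(LINT s|lborel. poly p (\<gamma> s) * \<gamma> s ^ (M - N) * exp (- (of_nat M * \<gamma> s)) * path_deriv \<gamma> s)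
      = laguerre_functional p"
proof -
  define f where "f x = poly p x * x ^ (M - N) * exp (- (of_nat M * x))" for x :: complex
  have "f holomorphic_on UNIV" unfolding f_def by (intro holomorphic_intros)
  then have "(LINT s|lborel. f (\<gamma> s) * path_deriv \<gamma> s) =
      (LINT s|lborel. f (of_real s) * path_deriv of_real s)"
    using integrable_entire_laguerre[OF path] integrable_entire_laguerre[OF half_line_path_of_real]
    unfolding f_def by (intro entire_integral_path_independent path half_line_path_of_real)
  also have "\<dots> = laguerre_functional p"
    unfolding laguerre_functional_def set_lebesgue_integral_def
    by (intro Bochner_Integration.integral_cong)
       (auto simp: path_deriv_of_real f_def laguerre_weight_def indicator_def exp_of_real[symmetric])
  finally show ?thesis by (simp add: f_def)
qed

lemma integrable_laguerre_functional:
  fixes p :: "complex poly"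
  shows "set_integrable lborel {0<..} (\<lambda>x. poly p (of_real x) * of_real (laguerre_weight x))"
  unfolding set_integrable_def
  by (rule back_subst[of "integrable lborel", OF
      integrable_entire_laguerre[OF half_line_path_of_real, of p]])
     (auto simp: fun_eq_iff path_deriv_of_real laguerre_weight_def indicator_def exp_of_real[symmetric])

lemma laguerre_functional_add:
  fixes p q :: "complex poly"
  shows "laguerre_functional (p + q) = laguerre_functional p + laguerre_functional q"
  unfolding laguerre_functional_def poly_add distrib_right
  by (rule set_integral_add(2)[OF integrable_laguerre_functional integrable_laguerre_functional])

lemma laguerre_functional_smult: "laguerre_functional (Polynomial.smult a p) = a * laguerre_functional p"
  unfolding laguerre_functional_def by (simp add: mult.assoc)

text \<open>The two square roots cancel in \<open>w * (x (t - c x) w) = x\<^sup>M\<^sup>-\<^sup>N exp (- M x)\<close>.\<close>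

lemma eps_form_density_deriv_operator:
  assumes t: "t \<in> U"
  shows "eps_form (path_density t p) (path_density t (deriv_operator t q)) = laguerre_functional (p * q)"
proof -
  have "path_density t p s * eps_transform (path_density t (deriv_operator t q)) s
      = poly (p * q) (\<gamma> s) * \<gamma> s ^ (M - N) * exp (- (of_nat M * \<gamma> s)) * path_deriv \<gamma> s" for s
  proof (cases "0 < s")
    case True
    then have s0: "0 \<le> s" by simp
    have nz: "\<gamma> s \<noteq> 0" using half_line_path_nonzero[OF path True] .
    have "of_real exponent + of_real (exponent + 1) = (of_nat (M - N) :: complex)"
      using N_less_M by (simp add: exponent_def of_nat_diff field_simps)
    then have "\<gamma> s powr of_real exponent * \<gamma> s powr of_real (exponent + 1) = \<gamma> s ^ (M - N)"
      using nz by (metis powr_add powr_nat')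
    moreover have "exp (- (of_real rate * \<gamma> s)) * exp (- (of_real rate * \<gamma> s)) = exp
        (- (of_nat M * \<gamma> s))"
      by (simp add: rate_def flip: exp_add)
    moreover have "path_density t p s * primitive t q s = poly p (\<gamma> s) * poly q (\<gamma> s)
        * (\<gamma> s powr of_real exponent * \<gamma> s powr of_real (exponent + 1))
        * (exp (- (of_real rate * \<gamma> s)) * exp (- (of_real rate * \<gamma> s))) * path_deriv \<gamma> s"
      unfolding path_density_def weight_eq primitive_def using branch_nonzero[OF t s0] by simp
    ultimately show ?thesis
      using eps_transform_density_deriv_operator[OF t s0] by simp
  qed (simp add: path_density_def path_deriv_nonpos)
  then show ?thesis
    unfolding eps_form_def by (simp only: laguerre_functional_path)
qed

text \<open>The functional is positive definite, since \<open>p (x) cnj (p (x)) = \<bar>p (x)\<bar>\<^sup>2\<close> on the half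
  line and a nonzero polynomial has only finitely many roots.\<close>

lemma laguerre_functional_definite:
  assumes "laguerre_functional (p * map_poly cnj p) = 0"
  shows "p = 0"
proof (rule ccontr)
  assume p: "p \<noteq> 0"
  have eq: "indicator {0<..} x *\<^sub>R (poly (p * map_poly cnj p) (of_real x) * of_real (laguerre_weight x))
      = complex_of_real (indicator {0<..} x * ((norm (poly p (of_real x)))\<^sup>2 * laguerre_weight x))"
          for x :: real
  proof -
    have "poly (map_poly cnj p) (of_real x) = cnj (poly p (of_real x))"
      by (metis complex_cnj_complex_of_real poly_cnj)
    then show ?thesis by (simp add: indicator_def complex_norm_square[symmetric])
  qed
  let ?g = "\<lambda>x::real. indicator {0<..} x * ((norm (poly p (of_real x)))\<^sup>2 * laguerre_weight x)"
  have int: "integrable lborel ?g"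
    using integrable_laguerre_functional[of "p * map_poly cnj p"]
    unfolding set_integrable_def eq by (subst (asm) complex_of_real_integrable_eq)
  have "complex_of_real (LINT x|lborel. ?g x) = 0"
    using assms unfolding laguerre_functional_def set_lebesgue_integral_def eq
    by (simp only: integral_complex_of_real)
  then have "(LINT x|lborel. ?g x) = 0" by (simp only: of_real_eq_0_iff)
  moreover have nonneg: "0 \<le> ?g x" for x by (auto simp: indicator_def laguerre_weight_def)
  ultimately have "AE x in lborel. ?g x = 0"
    using integral_nonneg_eq_0_iff_AE[OF int] by simp
  then have "AE x in lborel. x \<in> {0<..} \<longrightarrow> poly p (complex_of_real x) = 0"
    by eventually_elim (auto simp: laguerre_weight_def)
  moreover have "AE x in lborel. x \<notin> {x. poly p (complex_of_real x) = 0}"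
  proof -
    have "finite (complex_of_real -` {z. poly p z = 0})"
      using poly_roots_finite[OF p] by (intro finite_vimageI) (auto simp: inj_def)
    then have "countable {x. poly p (complex_of_real x) = 0}"
      by (auto simp: vimage_def intro: countable_finite)
    then show ?thesis by (intro AE_not_in countable_imp_null_set_lborel)
  qed
  ultimately have "AE x in lborel. x \<notin> {0<..<1::real}"
    by eventually_elim auto
  then have "emeasure lborel {0<..<1::real} = 0"
    by (subst (asm) AE_iff_measurable[of "{0<..<1::real}"]) (simp_all add: set_eq_iff)
  then show False by simp
qed

section \<open>Nondegeneracy from the Laguerre polynomials\<close>

lemma laguerre_functional_of_real:
  "laguerre_functional (map_poly of_real p) =
    of_real (LINT x:{0<..}|lborel. poly p x * laguerre_weight x)"
proof -
  have "poly (map_poly complex_of_real p) (of_real x) = of_real (poly p x)" for x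
    by (induction p) (auto simp: map_poly_pCons)
  then show ?thesis
    unfolding laguerre_functional_def set_lebesgue_integral_def
    by (simp flip: of_real_mult integral_complex_of_real add: scaleR_conv_of_real)
qed

abbreviation laguerre_poly :: "(nat \<Rightarrow> real poly) \<Rightarrow> nat \<Rightarrow> complex poly" where
  "laguerre_poly L j \<equiv> map_poly complex_of_real (L j)"

lemma
  assumes "monic_laguerre M N L"
  shows degree_laguerre_poly: "degree (laguerre_poly L j) = j"
    and coeff_laguerre_poly: "coeff (laguerre_poly L j) j = 1"
proof -
  from assms have deg: "degree (L j) = j" and lead: "coeff (L j) (degree (L j)) = 1"
    unfolding monic_laguerre_def monic_of_degree_def by blast+
  show "degree (laguerre_poly L j) = j" "coeff (laguerre_poly L j) j = 1"
    using lead unfolding deg by (simp_all add: degree_map_poly coeff_map_poly deg)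
qed

lemma laguerre_functional_mult_laguerre_poly:
  assumes L: "monic_laguerre M N L" and q: "\<forall>k\<ge>n. coeff q k = 0"
  shows "laguerre_functional (laguerre_poly L n * q) = 0"
proof (rule monic_family_span[of n "laguerre_poly L" "\<lambda>q. laguerre_functional
    (laguerre_poly L n * q) = 0"])
  show "\<forall>k\<ge>n. coeff q k = 0" by (rule q)
  show "monic_of_degree j (laguerre_poly L j)" for j
    using degree_laguerre_poly[OF L] coeff_laguerre_poly[OF L] by (simp add: monic_of_degree_def)
  show "laguerre_functional (laguerre_poly L n * laguerre_poly L j) = 0" if "j < n" for j
  proof -
    have "laguerre_poly L n * laguerre_poly L j = map_poly of_real (L n * L j)"
      by (simp add: poly_eq_iff coeff_map_poly coeff_mult)
    then show ?thesis
      using L that by (simp add: laguerre_functional_of_real monic_laguerre_def laguerre_weight_def)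
  qed
  show "laguerre_functional (laguerre_poly L n * 0) = 0"
    using laguerre_functional_smult[of 0 0] by simp
qed (simp_all add: laguerre_functional_add laguerre_functional_smult distrib_left)

text \<open>An element \<open>f\<close> of the kernel is orthogonal to \<open>D q\<close> for every \<open>q\<close> of degree below \<open>N -
  2\<close>, which says that \<open>f q\<close> has vanishing Laguerre moment. Removing the top two Laguerre
  components of \<open>f\<close> leaves a polynomial \<open>g\<close> that is orthogonal to its own conjugate, so \<open>g =
  0\<close>. The two remaining coefficients are found by pairing with \<open>L\<^sub>N\<^sub>-\<^sub>1\<close> and \<open>L\<^sub>N\<^sub>-\<^sub>2\<close>.\<close>

lemma skew_form_kernel_trivial:
  assumes t: "t \<in> U" and N: "2 < N" and L: "monic_laguerre M N L"
    and nz: "eps_form (path_density t (laguerre_poly L (N - 1)))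
        (path_density t (laguerre_poly L (N - 2))) \<noteq> 0"
    and deg: "degree f < N"
    and ker: "\<And>i. i < N \<Longrightarrow>
      (\<Sum>k<N. eps_form (path_density t (monom 1 i)) (path_density t (monom 1 k)) * coeff f k) = 0"
  shows "f = 0"
proof -
  let ?B = "\<lambda>p q. eps_form (path_density t p) (path_density t q)"
  have left: "?B p f = 0" if "degree p < N" for p
    unfolding eps_form_density_expansion[OF t that deg] mult.assoc sum_distrib_left[symmetric]
    using ker by simp
  have orth: "laguerre_functional (f * q) = 0" if q: "\<forall>k\<ge>N - 2. coeff q k = 0" for q
  proof -
    have "degree q < N - 2" using q N by (intro degree_lessI) auto
    then have "degree (deriv_operator t q) < N" using degree_deriv_operator[of q "N - 2" t] N by simp
    then have "?B f (deriv_operator t q) = 0"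
      using left eps_form_density_swap[OF t, of f "deriv_operator t q"] by simp
    then show ?thesis using eps_form_density_deriv_operator[OF t] by simp
  qed
  define L1 where "L1 = laguerre_poly L (N - 1)"
  define L2 where "L2 = laguerre_poly L (N - 2)"
  have L12: "degree L1 = N - 1" "coeff L1 (N - 1) = 1" "degree L2 = N - 2" "coeff L2 (N - 2) = 1"
    using degree_laguerre_poly[OF L] coeff_laguerre_poly[OF L] by (simp_all add: L1_def L2_def)
  define a where "a = coeff f (N - 1)"
  define b where "b = coeff (f - Polynomial.smult a L1) (N - 2)"
  define g where "g = f - Polynomial.smult a L1 - Polynomial.smult b L2"
  have g: "\<forall>k\<ge>N - 2. coeff g k = 0"
  proof (intro allI impI)
    fix k assume "N - 2 \<le> k"
    then consider "k = N - 2" | "k = N - 1" | "N \<le> k" by linarith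
    then show "coeff g k = 0"
    proof cases
      case 1 then show ?thesis using L12 by (simp add: g_def b_def)
    next
      case 2
      then have "coeff L2 k = 0" using L12 N by (intro coeff_eq_0) auto
      with 2 show ?thesis using L12 by (simp add: g_def a_def)
    next
      case 3
      then have "coeff f k = 0" "coeff L1 k = 0" "coeff L2 k = 0"
        using L12 N deg by (auto intro!: coeff_eq_0)
      then show ?thesis by (simp add: g_def)
    qed
  qed
  define h where "h = map_poly cnj g"
  have h: "\<forall>k\<ge>N - 2. coeff h k = 0" using g by (simp add: h_def coeff_map_poly)
  have h': "\<forall>k\<ge>N - 1. coeff h k = 0" using h by (auto intro: order_trans)
  have "f * h = g * h + Polynomial.smult a (L1 * h) + Polynomial.smult b (L2 * h)"
    by (simp add: g_def algebra_simps)
  then have "laguerre_functional (f * h) = laguerre_functional (g * h)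
      + a * laguerre_functional (L1 * h) + b * laguerre_functional (L2 * h)"
    by (simp add: laguerre_functional_add laguerre_functional_smult)
  then have "laguerre_functional (g * h) = 0"
    using orth[OF h] laguerre_functional_mult_laguerre_poly[OF L h]
        laguerre_functional_mult_laguerre_poly[OF L h']
    by (simp add: L1_def L2_def)
  then have "g = 0" unfolding h_def by (rule laguerre_functional_definite)
  then have f: "f = Polynomial.smult a L1 + Polynomial.smult b L2" by (simp add: g_def algebra_simps)
  have lin: "?B f p = a * ?B L1 p + b * ?B L2 p" for p
  proof -
    have "path_density t f s * eps_transform (path_density t p) s =
        a * (path_density t L1 s * eps_transform (path_density t p) s)
        + b * (path_density t L2 s * eps_transform (path_density t p) s)" for s
      unfolding path_density_def by (subst f) (simp add: algebra_simps)
    then show ?thesis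
      unfolding eps_form_def using integrable_mult_eps_transform[OF integrable_density[OF t]
          integrable_density[OF t]]
      by simp
  qed
  have nz': "?B L1 L2 \<noteq> 0" using nz by (simp add: L1_def L2_def)
  have right: "?B f p = 0" if "degree p < N" for p
    using left[OF that] eps_form_density_swap[OF t, of f p] by simp
  have "b = 0"
    using right[of L1] lin[of L1] L12(1) N nz' eps_form_density_self[OF t]
        eps_form_density_swap[OF t, of L2 L1] by simp
  moreover have "a = 0"
    using right[of L2] lin[of L2] L12(3) N nz' eps_form_density_self[OF t] by simp
  ultimately show ?thesis using f by simp
qed

section \<open>The determinant and its logarithmic derivative\<close>

lemma moment_mat_eq:
  "moment_mat \<gamma> (weight M N rt t) n R =
    Matrix.mat n n (\<lambda>(j, k). eps_form (path_density t (R j)) (path_density t (R k)))"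
  by (simp add: moment_mat_def skew_prod_eq_eps_form)

lemma moment_mat_carrier: "moment_mat \<gamma> (weight M N rt t) n R \<in> carrier_mat n n"
  by (simp add: moment_mat_eq)

lemma moment_det_monic:
  assumes t: "t \<in> U" and R: "\<And>j. j < n \<Longrightarrow> monic_of_degree j (R j)"
  shows "moment_det \<gamma> (weight M N rt t) n R = Determinant.det (Matrix.mat n n
    (\<lambda>(i, k). eps_form (path_density t (monom 1 i)) (path_density t (monom 1 k))))"
  unfolding moment_det_def moment_mat_eq
  by (rule det_gram_monic[OF eps_form_density_expansion[OF t] R])

lemma moment_det_nonzero:
  assumes t: "t \<in> U" and N: "2 < N" and L: "monic_laguerre M N L"
    and nz: "laguerre_skew \<gamma> (weight M N rt t) L (N - 1) (N - 2) \<noteq> 0"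
    and R: "\<And>j. j < N \<Longrightarrow> monic_of_degree j (R j)"
  shows "moment_det \<gamma> (weight M N rt t) N R \<noteq> 0"
proof
  assume "moment_det \<gamma> (weight M N rt t) N R = 0"
  then have det: "Determinant.det (Matrix.mat N N
      (\<lambda>(i, k). eps_form (path_density t (monom 1 i)) (path_density t (monom 1 k)))) = 0"
    by (simp only: moment_det_monic[OF t R])
  have "0 < N" using N by simp
  from singular_matrix_poly_kernel[OF this det] obtain f where f: "f \<noteq> 0" "degree f < N"
    "\<And>i. i < N \<Longrightarrow> (\<Sum>k<N. eps_form (path_density t (monom 1 i)) (path_density t (monom 1 k))
        * coeff f k) = 0"
    by blast
  have "f = 0"
    using nz f(2,3) unfolding laguerre_skew_def skew_prod_eq_eps_form
    by (rule skew_form_kernel_trivial[OF t N L])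
  with f(1) show False ..
qed

lemma moment_det_inverse:
  assumes "moment_det \<gamma> (weight M N rt t) n R \<noteq> 0"
  obtains B where "the (mat_inverse (moment_mat \<gamma> (weight M N rt t) n R)) = B" "B \<in> carrier_mat n n"
    "moment_mat \<gamma> (weight M N rt t) n R * B = 1\<^sub>m n" "B * moment_mat \<gamma> (weight M N rt t) n R = 1\<^sub>m n"
proof -
  let ?A = "moment_mat \<gamma> (weight M N rt t) n R"
  have "?A \<in> Units (ring_mat TYPE(complex) n ())"
    using assms unfolding moment_det_def by (rule det_non_zero_imp_unit[OF moment_mat_carrier])
  then have "mat_inverse ?A \<noteq> None"
    using mat_inverse(1)[OF moment_mat_carrier] by metis
  then obtain B where "mat_inverse ?A = Some B" by auto
  with mat_inverse(2)[OF moment_mat_carrier this] show ?thesis by (intro that[of B]) auto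
qed

text \<open>Jacobi's formula yields \<open>\<Sum> B\<^sub>j\<^sub>k (X\<^sub>j\<^sub>k - X\<^sub>k\<^sub>j) / 2\<close>; the inverse \<open>B\<close> of an
  antisymmetric matrix is antisymmetric, so the two halves are equal.\<close>

lemma moment_det_has_field_derivative:
  assumes t0: "t0 \<in> U" and nz: "moment_det \<gamma> (weight M N rt t0) n R \<noteq> 0"
  defines "B \<equiv> the (mat_inverse (moment_mat \<gamma> (weight M N rt t0) n R))"
  shows "((\<lambda>t. moment_det \<gamma> (weight M N rt t) n R) has_field_derivative
    moment_det \<gamma> (weight M N rt t0) n R * (\<Sum>j<n. \<Sum>k<n. B $$ (j, k) *
      eps_form (\<lambda>s. path_density t0 (R j) s * pole_factor t0 s) (path_density t0 (R k)))) (at t0)"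
proof -
  let ?A = "\<lambda>t. moment_mat \<gamma> (weight M N rt t) n R"
  define X where "X j k = eps_form (\<lambda>s. path_density t0 (R j) s * pole_factor t0 s)
      (path_density t0 (R k))" for j k
  have inv: "B \<in> carrier_mat n n" "?A t0 * B = 1\<^sub>m n" "B * ?A t0 = 1\<^sub>m n"
    using moment_det_inverse[OF nz] by (auto simp: B_def)
  have anti: "B $$ (j, k) = - B $$ (k, j)" if "j < n" "k < n" for j k
    using moment_mat_carrier inv(1,2,3) _ that
  proof (rule antisymmetric_inverse)
    fix i l assume "i < n" "l < n"
    then show "?A t0 $$ (i, l) = - ?A t0 $$ (l, i)"
      using eps_form_density_swap[OF t0, of "R i" "R l"] by (simp add: moment_mat_eq)
  qed
  have "((\<lambda>t. Determinant.det (?A t)) has_field_derivative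
      Determinant.det (?A t0) * (\<Sum>j<n. \<Sum>k<n. B $$ (j, k) * ((X j k - X k j) / 2))) (at t0)"
  proof (rule has_field_derivative_det[where A = ?A and A' = "\<lambda>k j.
      (X j k - X k j) / 2", OF moment_mat_carrier inv(1,3)])
    fix i j assume "i < n" "j < n"
    then show "((\<lambda>t. ?A t $$ (i, j)) has_field_derivative (X j i - X i j) / 2) (at t0)"
      unfolding X_def using eps_form_density_has_field_derivative[OF t0, of "R i" "R j"]
      by (simp add: moment_mat_eq)
  qed
  moreover have "(\<Sum>j<n. \<Sum>k<n. B $$ (j, k) * ((X j k - X k j) / 2)) = (\<Sum>j<n. \<Sum>k<n. B $$ (j, k) * X j k)"
  proof -
    have "(\<Sum>j<n. \<Sum>k<n. B $$ (j, k) * X k j) = (\<Sum>j<n. \<Sum>k<n. B $$ (k, j) * X j k)"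
      by (rule sum.swap)
    also have "\<dots> = (\<Sum>j<n. \<Sum>k<n. - (B $$ (j, k) * X j k))"
    proof (intro sum.cong refl)
      fix j k assume "j \<in> {..<n}" "k \<in> {..<n}"
      then show "B $$ (k, j) * X j k = - (B $$ (j, k) * X j k)" using anti[of k j] by simp
    qed
    finally have "(\<Sum>j<n. \<Sum>k<n. B $$ (j, k) * X k j) = - (\<Sum>j<n. \<Sum>k<n. B $$ (j, k) * X j k)"
      by (simp add: sum_negf)
    then show ?thesis
      by (simp add: right_diff_distrib diff_divide_distrib sum_subtractf flip: sum_divide_distrib)
  qed
  ultimately show ?thesis by (simp add: moment_det_def X_def)
qed

lemma
  assumes t0: "t0 \<in> U"
  defines "B \<equiv> \<lambda>n R. the (mat_inverse (moment_mat \<gamma> (weight M N rt t0) n R))"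
  shows S1_pole_integrable: "set_integrable lborel {0..}
      (\<lambda>s. S1 \<gamma> (weight M N rt t0) n R s s / (t0 - of_real c * \<gamma> s) * vector_derivative \<gamma> (at s))"
    and S1_pole_integral: "path_int \<gamma> (\<lambda>s. S1 \<gamma> (weight M N rt t0) n R s s / (t0 - of_real c * \<gamma> s)) =
      - (\<Sum>j<n. \<Sum>k<n. B n R $$ (j, k) *
        eps_form (\<lambda>s. path_density t0 (R j) s * pole_factor t0 s) (path_density t0 (R k)))"
proof -
  let ?F = "\<lambda>s. - (\<Sum>j<n. \<Sum>k<n. B n R $$ (j, k) *
      (path_density t0 (R j) s * pole_factor t0 s * eps_transform (path_density t0 (R k)) s))"
  have eq: "S1 \<gamma> (weight M N rt t0) n R s s / (t0 - of_real c * \<gamma> s) * path_deriv \<gamma> s = ?F s" for s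
  proof -
    have "S1 \<gamma> (weight M N rt t0) n R s s / (t0 - of_real c * \<gamma> s) * path_deriv \<gamma> s =
        - (\<Sum>j<n. \<Sum>k<n. poly (R j) (\<gamma> s) * weight M N rt t0 (\<gamma> s) * B n R $$ (j, k)
            * eps_transform (path_density t0 (R k)) s * (pole_factor t0 s * path_deriv \<gamma> s))"
      unfolding S1_def Let_def eps_op_eq_eps_transform B_def sum_distrib_right[symmetric]
      by (simp add: pole_factor_def)
    then show ?thesis by (simp add: path_density_def mult_ac)
  qed
  have int: "integrable lborel
      (\<lambda>s. path_density t0 (R j) s * pole_factor t0 s * eps_transform (path_density t0 (R k)) s)" for j k
    by (rule integrable_mult_eps_transform[OF integrable_density_pole_factor[OF t0]
        integrable_density[OF t0]])
  show "set_integrable lborel {0..}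
      (\<lambda>s. S1 \<gamma> (weight M N rt t0) n R s s / (t0 - of_real c * \<gamma> s) * vector_derivative \<gamma> (at s))"
    unfolding set_integrable_path_iff[OF path] eq using int by simp
  show "path_int \<gamma> (\<lambda>s. S1 \<gamma> (weight M N rt t0) n R s s / (t0 - of_real c * \<gamma> s)) =
      - (\<Sum>j<n. \<Sum>k<n. B n R $$ (j, k) *
        eps_form (\<lambda>s. path_density t0 (R j) s * pole_factor t0 s) (path_density t0 (R k)))"
    unfolding path_int_eq[OF path] eq eps_form_def using int by simp
qed

end

theorem proposition2:
  fixes M N :: nat and \<tau> :: real
    and \<gamma> :: "real \<Rightarrow> complex"
    and U :: "complex set" and t0 :: complex
    and rt :: "complex \<Rightarrow> complex \<Rightarrow> complex"
    and w :: "complex \<Rightarrow> complex \<Rightarrow> complex"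
    and L :: "nat \<Rightarrow> real poly"
    and p :: "nat \<Rightarrow> complex poly"
    and r :: "complex \<Rightarrow> nat \<Rightarrow> complex poly"
  defines "w \<equiv> weight M N rt"
  assumes "N < M" and "4 \<le> N" and "even N"
    and "0 < 1 + \<tau>" and "\<tau> \<noteq> 0"
    and "half_line_path \<gamma>"
    and "open U" and "t0 \<in> U"
    and "sqrt_branch (tau_tilde \<tau>) \<gamma> U rt"
    and "monic_laguerre M N L"
    and "laguerre_skew \<gamma> (w t0) L (N - 1) (N - 2) \<noteq> 0"
    and "laguerre_skew \<gamma> (w t0) L (N - 3) (N - 4) \<noteq> 0"
    and "\<And>j. j < N - 2 \<Longrightarrow> monic_of_degree j (p j)"
    and "\<And>t j. t \<in> U \<Longrightarrow> j < N - 2 \<Longrightarrow> r t j = p j"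
    and "\<And>t. t \<in> U \<Longrightarrow> skew_orthogonal_poly \<gamma> (w t) (N - 2) (r t (N - 2))"
    and "\<And>t. t \<in> U \<Longrightarrow> skew_orthogonal_poly \<gamma> (w t) (N - 1) (r t (N - 1))"
  shows "moment_det \<gamma> (w t0) N (r t0) \<noteq> 0
    \<and> (\<lambda>t. moment_det \<gamma> (w t) N (r t)) field_differentiable (at t0)
    \<and> set_integrable lborel {0..}
        (\<lambda>s. S1 \<gamma> (w t0) N (r t0) s s / (t0 - of_real (tau_tilde \<tau>) * \<gamma> s)
               * vector_derivative \<gamma> (at s))
    \<and> deriv (\<lambda>t. moment_det \<gamma> (w t) N (r t)) t0 / moment_det \<gamma> (w t0) N (r t0)
        = - path_int \<gamma> (\<lambda>s. S1 \<gamma> (w t0) N (r t0) s s / (t0 - of_real (tau_tilde \<tau>) * \<gamma> s))"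
proof -
  note t0 = \<open>t0 \<in> U\<close>
  have "tau_tilde \<tau> \<noteq> 0"
    using \<open>0 < 1 + \<tau>\<close> \<open>\<tau> \<noteq> 0\<close> by (simp add: tau_tilde_def)
  interpret spiked_weight M N \<gamma> "tau_tilde \<tau>" U rt
    using assms \<open>tau_tilde \<tau> \<noteq> 0\<close> by unfold_locales auto
  have monic: "monic_of_degree j (r t j)" if "t \<in> U" "j < N" for t j
  proof -
    have "j < N - 2 \<or> j = N - 2 \<or> j = N - 1" using \<open>j < N\<close> by linarith
    then show ?thesis
      using assms(14-17) \<open>t \<in> U\<close> by (elim disjE) (simp_all add: skew_orthogonal_poly_def)
  qed
  have nz: "moment_det \<gamma> (w t0) N (r t0) \<noteq> 0"
    unfolding w_def
    by (rule moment_det_nonzero[OF t0 _ \<open>monic_laguerre M N L\<close>])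
       (use assms monic[OF t0] in auto)
  let ?D = "- path_int \<gamma> (\<lambda>s. S1 \<gamma> (w t0) N (r t0) s s / (t0 - of_real (tau_tilde \<tau>) * \<gamma> s))"
  \<comment> \<open>The family is held fixed at its value for \<open>t0\<close>: \<open>r t (N - 1)\<close> is determined only up to a
    multiple of \<open>r t (N - 2)\<close> and may depend on \<open>t\<close> in any way, while the determinant does not
    see the choice.\<close>
  have "((\<lambda>t. moment_det \<gamma> (w t) N (r t0)) has_field_derivative moment_det \<gamma> (w t0) N (r t0) * ?D)
      (at t0)"
    using moment_det_has_field_derivative[OF t0 nz[unfolded w_def]] S1_pole_integral[OF t0, of N "r t0"]
    by (simp add: w_def)
  then have der: "((\<lambda>t. moment_det \<gamma> (w t) N (r t)) has_field_derivative moment_det \<gamma> (w t0) N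
      (r t0) * ?D) (at t0)"
  proof (rule has_field_derivative_transform_within_open[OF _ \<open>open U\<close> t0])
    fix t assume "t \<in> U"
    then show "moment_det \<gamma> (w t) N (r t0) = moment_det \<gamma> (w t) N (r t)"
      unfolding w_def using moment_det_monic[of t N] monic t0 by simp
  qed
  show ?thesis
    using nz der DERIV_imp_deriv[OF der] S1_pole_integrable[OF t0, of N "r t0"]
    by (auto simp: field_differentiable_def w_def)
qed

end
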